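(* An oriented graph $D$ is a global K-graph if and only if it is a K-graph.
   Context: **Digraphs.** A digraph is an irreflexive binary relation $D$ on a finite nonempty set, the set of vertices of $D$. The ordered pairs in $D$ are its edges; an edge $(a,b)$ begins in $a$ and ends in $b$. An oriented graph is an antisymmetric digraph (if $(a,b)\in D$ then $(b,a)\notin D$). A W-vertex of $D$ is a vertex in which no edge ends; an E-vertex is a vertex in which no edge begins; an inner vertex is one that is neither. A W-edge is an edge beginning in a W-vertex; an E-edge is an edge ending in an E-vertex. A W-edge $(a,b)$ is functional when $(a,c)\in D$ implies $c=b$; an E-edge $(b,a)$ is functional when $(c,a)\in D$ implies $c=b$. Digraphs are disjoint when their vertex sets are disjoint. **Semipaths.** For $n\ge 1$ consider a sequence $a_1,\dots,a_n$ of vertices such that for every $i\in\{1,\dots,n-1\}$ we have $(a_i,a_{i+1})\in D$ or $(a_{i+1},a_i)\in D$. It is a semipath when all its vertices are mutually distinct (joining $a_1$ to $a_n$); it is a semicycle when $a_1=a_n$, $n\ge 4$, and $a_1,\dots,a_{n-1}$ are mutually distinct. A path is a semipath with $(a_i,a_{i+1})\in D$ for every $i\in\{1,\dots,n-1\}$. The cognate of a semipath is the same sequence in inverse order. $D$ is weakly connected when every two vertices are joined by a semipath; asemicyclic when it has no semicycles; W-E-functional when all its W-edges and E-edges are functional. **Basic K-graphs.** A basic K-graph $B$ is an oriented graph with vertices $a_1,\dots,a_{k_W},b,c_1,\dots,c_{k_E}$ (all distinct, $k_W,k_E\ge 1$) and edges exactly $(a_i,b)$ for $1\le i\le k_W$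 and $(b,c_j)$ for $1\le j\le k_E$, together with distinguished W-edges $NW(B),SW(B)$ and distinguished E-edges $NE(B),SE(B)$, such that for each $X\in\{W,E\}$: if $k_X\ge 2$, then $NX(B)\ne SX(B)$. **Cut.** Let $D_W,D_E$ be disjoint oriented graphs, $e_W=(a,b)$ a functional E-edge of $D_W$ and $e_E=(c,d)$ a functional W-edge of $D_E$. With $e=(a,d)$, $D_W[e_W-e_E]D_E$ is the oriented graph $(D_W-\{e_W\})\cup(D_E-\{e_E\})\cup\{e\}$ on the union of the vertices of $D_W$ and $D_E$ with $b$ and $c$ omitted. **Constructions.** A construction $G$ is a finite binary tree with an oriented graph and distinguished edges at each node; the graph at the root is the root graph of $G$, and its distinguished edges at the root are denoted $YX(G)$, $Y\in\{N,S\}$, $X\in\{W,E\}$. Constructions are defined inductively: (1) a single-node tree whose node carries a basic K-graph $B$ with its distinguished edges is a construction; (2) if $G_W,G_E$ are constructions with disjoint root graphs $D_W,D_E$, $e_W$ is a functional E-edge of $D_W$ and $e_E$ is a functional W-edge of $D_E$, and for every $Y\in\{N,S\}$ we have $e_W=YE(G_W)$ or $e_E=YW(G_E)$, then $G=G_W[e_W-e_E]G_E$ is a construction: its tree has a new root whose successors are the roots of $G_W$ and $G_E$, its root graph is $D_W[e_W-e_E]D_E$, and for $Y\in\{N,S\}$, $YW(G)=YW(G_W)$ if $e_E=YW(G_E)$ and $YW(G)=YW(G_E)$ otherwise; $YE(G)=YE(G_E)$ if $e_W=YE(G_W)$ and $YE(G)=YE(G_W)$ otherwise. The other nodes keep their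 data from $G_W$ and $G_E$. A global K-graph is an oriented graph that is the root graph of a construction. **K-graphs.** A proper semipath is a semipath such that neither it nor its cognate is a path. An edge $(a,b)$ of an oriented graph is transversal when there is a proper semipath $a,b,\dots,c$ (starting with $a,b$) and a proper semipath $b,a,\dots,d$ (starting with $b,a$). A bifurcation is a triple of different edges that have a common vertex; it is transversal when all three edges in it are transversal. A K-graph is an oriented graph that is weakly connected, asemicyclic, W-E-functional, has an inner vertex, and in which no bifurcation is transversal. *)

theory Defs
  imports "Graph_Theory.Pair_Digraph"
begin

section \<open>Digraphs and oriented graphs\<close>

text \<open>\<^locale>\<open>pair_digraph\<close> is a finite loop-free relation on a possibly empty vertex set.\<close>

definition is_digraph :: "'a pair_pre_digraph \<Rightarrow> bool" where
  "is_digraph D \<longleftrightarrow> pair_digraph D \<and> pverts D \<noteq> {}"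

definition oriented_graph :: "'a pair_pre_digraph \<Rightarrow> bool" where
  "oriented_graph D \<longleftrightarrow> is_digraph D \<and> (\<forall>a b. (a, b) \<in> parcs D \<longrightarrow> (b, a) \<notin> parcs D)"

definition disjoint_graphs :: "'a pair_pre_digraph \<Rightarrow> 'a pair_pre_digraph \<Rightarrow> bool" where
  "disjoint_graphs D D' \<longleftrightarrow> pverts D \<inter> pverts D' = {}"

definition W_vertex :: "'a pair_pre_digraph \<Rightarrow> 'a \<Rightarrow> bool" where
  "W_vertex D v \<longleftrightarrow> v \<in> pverts D \<and> (\<forall>a. (a, v) \<notin> parcs D)"

definition E_vertex :: "'a pair_pre_digraph \<Rightarrow> 'a \<Rightarrow> bool" where
  "E_vertex D v \<longleftrightarrow> v \<in> pverts D \<and> (\<forall>a. (v, a) \<notin> parcs D)"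

definition inner_vertex :: "'a pair_pre_digraph \<Rightarrow> 'a \<Rightarrow> bool" where
  "inner_vertex D v \<longleftrightarrow> v \<in> pverts D \<and> \<not> W_vertex D v \<and> \<not> E_vertex D v"

definition W_edge :: "'a pair_pre_digraph \<Rightarrow> 'a \<times> 'a \<Rightarrow> bool" where
  "W_edge D e \<longleftrightarrow> e \<in> parcs D \<and> W_vertex D (fst e)"

definition E_edge :: "'a pair_pre_digraph \<Rightarrow> 'a \<times> 'a \<Rightarrow> bool" where
  "E_edge D e \<longleftrightarrow> e \<in> parcs D \<and> E_vertex D (snd e)"

definition functional_W_edge :: "'a pair_pre_digraph \<Rightarrow> 'a \<times> 'a \<Rightarrow> bool" where
  "functional_W_edge D e \<longleftrightarrow> W_edge D e \<and> (\<forall>c. (fst e, c) \<in> parcs D \<longrightarrow> c = snd e)"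

definition functional_E_edge :: "'a pair_pre_digraph \<Rightarrow> 'a \<times> 'a \<Rightarrow> bool" where
  "functional_E_edge D e \<longleftrightarrow> E_edge D e \<and> (\<forall>c. (c, snd e) \<in> parcs D \<longrightarrow> c = fst e)"

definition WE_functional :: "'a pair_pre_digraph \<Rightarrow> bool" where
  "WE_functional D \<longleftrightarrow>
     (\<forall>e. W_edge D e \<longrightarrow> functional_W_edge D e) \<and> (\<forall>e. E_edge D e \<longrightarrow> functional_E_edge D e)"


section \<open>Semipaths\<close>

definition semiwalk :: "'a pair_pre_digraph \<Rightarrow> 'a list \<Rightarrow> bool" where
  "semiwalk D xs \<longleftrightarrow> xs \<noteq> [] \<and> set xs \<subseteq> pverts D \<and>
     successively (\<lambda>x y. (x, y) \<in> parcs D \<or> (y, x) \<in> parcs D) xs"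

definition semipath :: "'a pair_pre_digraph \<Rightarrow> 'a list \<Rightarrow> bool" where
  "semipath D xs \<longleftrightarrow> semiwalk D xs \<and> distinct xs"

definition semicycle :: "'a pair_pre_digraph \<Rightarrow> 'a list \<Rightarrow> bool" where
  "semicycle D xs \<longleftrightarrow>
     semiwalk D xs \<and> hd xs = last xs \<and> length xs \<ge> 4 \<and> distinct (butlast xs)"

definition is_path :: "'a pair_pre_digraph \<Rightarrow> 'a list \<Rightarrow> bool" where
  "is_path D xs \<longleftrightarrow> semipath D xs \<and> successively (\<lambda>x y. (x, y) \<in> parcs D) xs"

text \<open>The cognate of a semipath is its \<^const>\<open>rev\<close>.\<close>

definition proper_semipath :: "'a pair_pre_digraph \<Rightarrow> 'a list \<Rightarrow> bool" where
  "proper_semipath D xs \<longleftrightarrow> semipath D xs \<and> \<not> is_path D xs \<and> \<not> is_path D (rev xs)"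

definition weakly_connected :: "'a pair_pre_digraph \<Rightarrow> bool" where
  "weakly_connected D \<longleftrightarrow>
     (\<forall>u\<in>pverts D. \<forall>v\<in>pverts D. \<exists>xs. semipath D xs \<and> hd xs = u \<and> last xs = v)"

definition asemicyclic :: "'a pair_pre_digraph \<Rightarrow> bool" where
  "asemicyclic D \<longleftrightarrow> (\<nexists>xs. semicycle D xs)"


section \<open>K-graphs\<close>

definition transversal_edge :: "'a pair_pre_digraph \<Rightarrow> 'a \<times> 'a \<Rightarrow> bool" where
  "transversal_edge D e \<longleftrightarrow> e \<in> parcs D \<and>
     (\<exists>xs. proper_semipath D (fst e # snd e # xs)) \<and>
     (\<exists>ys. proper_semipath D (snd e # fst e # ys))"

definition bifurcation ::
    "'a pair_pre_digraph \<Rightarrow> 'a \<times> 'a \<Rightarrow> 'a \<times> 'a \<Rightarrow> 'a \<times> 'a \<Rightarrow> bool" where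
  "bifurcation D e1 e2 e3 \<longleftrightarrow>
     {e1, e2, e3} \<subseteq> parcs D \<and> distinct [e1, e2, e3] \<and>
     (\<exists>v. \<forall>e\<in>{e1, e2, e3}. v = fst e \<or> v = snd e)"

definition transversal_bifurcation ::
    "'a pair_pre_digraph \<Rightarrow> 'a \<times> 'a \<Rightarrow> 'a \<times> 'a \<Rightarrow> 'a \<times> 'a \<Rightarrow> bool" where
  "transversal_bifurcation D e1 e2 e3 \<longleftrightarrow> bifurcation D e1 e2 e3 \<and>
     transversal_edge D e1 \<and> transversal_edge D e2 \<and> transversal_edge D e3"

definition K_graph :: "'a pair_pre_digraph \<Rightarrow> bool" where
  "K_graph D \<longleftrightarrow> oriented_graph D \<and> weakly_connected D \<and> asemicyclic D \<and> WE_functional D \<and>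
     (\<exists>v. inner_vertex D v) \<and> (\<nexists>e1 e2 e3. transversal_bifurcation D e1 e2 e3)"


section \<open>Constructions\<close>

datatype ns = North | South
datatype we = West | East

text \<open>An oriented graph together with its distinguished edges:
  \<open>dist_edge B Y X\<close> is the edge written $YX(B)$.\<close>

record 'a marked_graph =
  graph_of :: "'a pair_pre_digraph"
  dist_edge :: "ns \<Rightarrow> we \<Rightarrow> 'a \<times> 'a"

definition basic_K_graph :: "'a marked_graph \<Rightarrow> bool" where
  "basic_K_graph B \<longleftrightarrow> oriented_graph (graph_of B) \<and>
     (\<exists>A b C. finite A \<and> finite C \<and> card A \<ge> 1 \<and> card C \<ge> 1 \<and>
        A \<inter> C = {} \<and> b \<notin> A \<and> b \<notin> C \<and>
        graph_of B = \<lparr>pverts = A \<union> {b} \<union> C, parcs = A \<times> {b} \<union> {b} \<times> C\<rparr> \<and>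
        (\<forall>Y. W_edge (graph_of B) (dist_edge B Y West)) \<and>
        (\<forall>Y. E_edge (graph_of B) (dist_edge B Y East)) \<and>
        (card A \<ge> 2 \<longrightarrow> dist_edge B North West \<noteq> dist_edge B South West) \<and>
        (card C \<ge> 2 \<longrightarrow> dist_edge B North East \<noteq> dist_edge B South East))"

definition cut_graph ::
    "'a pair_pre_digraph \<Rightarrow> 'a \<times> 'a \<Rightarrow> 'a \<times> 'a \<Rightarrow> 'a pair_pre_digraph \<Rightarrow> 'a pair_pre_digraph" where
  "cut_graph DW eW eE DE =
     \<lparr>pverts = (pverts DW \<union> pverts DE) - {snd eW, fst eE},
      parcs = (parcs DW - {eW}) \<union> (parcs DE - {eE}) \<union> {(fst eW, snd eE)}\<rparr>"

datatype 'a ctree =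
    Single (root: "'a marked_graph")
  | Branch (root: "'a marked_graph") "'a ctree" "'a ctree"

definition root_graph :: "'a ctree \<Rightarrow> 'a pair_pre_digraph" where
  "root_graph G = graph_of (root G)"

definition root_edge :: "'a ctree \<Rightarrow> ns \<Rightarrow> we \<Rightarrow> 'a \<times> 'a" where
  "root_edge G = dist_edge (root G)"

fun cut_edge :: "'a ctree \<Rightarrow> 'a \<times> 'a \<Rightarrow> 'a \<times> 'a \<Rightarrow> 'a ctree \<Rightarrow> ns \<Rightarrow> we \<Rightarrow> 'a \<times> 'a" where
  "cut_edge GW eW eE GE Y West =
     (if eE = root_edge GE Y West then root_edge GW Y West else root_edge GE Y West)"
| "cut_edge GW eW eE GE Y East =
     (if eW = root_edge GW Y East then root_edge GE Y East else root_edge GW Y East)"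

definition cut_tree :: "'a ctree \<Rightarrow> 'a \<times> 'a \<Rightarrow> 'a \<times> 'a \<Rightarrow> 'a ctree \<Rightarrow> 'a ctree" where
  "cut_tree GW eW eE GE =
     Branch \<lparr>graph_of = cut_graph (root_graph GW) eW eE (root_graph GE),
             dist_edge = cut_edge GW eW eE GE\<rparr> GW GE"

inductive construction :: "'a ctree \<Rightarrow> bool" where
  basic: "basic_K_graph B \<Longrightarrow> construction (Single B)"
| cut: "construction GW \<Longrightarrow> construction GE \<Longrightarrow>
    disjoint_graphs (root_graph GW) (root_graph GE) \<Longrightarrow>
    functional_E_edge (root_graph GW) eW \<Longrightarrow>
    functional_W_edge (root_graph GE) eE \<Longrightarrow>
    (\<And>Y. eW = root_edge GW Y East \<or> eE = root_edge GE Y West) \<Longrightarrow>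
    construction (cut_tree GW eW eE GE)"

text \<open>Cuts omit vertices, so the root graph of a construction can have fewer vertices than the
  graphs it is built from. The type of vertices therefore has to be infinite for this notion
  to have its intended meaning.\<close>

definition global_K_graph :: "'a pair_pre_digraph \<Rightarrow> bool" where
  "global_K_graph D \<longleftrightarrow> oriented_graph D \<and> (\<exists>G. construction G \<and> root_graph G = D)"

end

theory Submission
  imports Defs
begin

text \<open>Removing an edge of a K-graph, which is a tree, leaves two sides. Call a side mixed if it contains
  both a W-vertex and an E-vertex. An edge is transversal iff both of its sides are mixed, so a
  bifurcation is transversal iff the three branches at its vertex are mixed.

  For a tree occurring in a construction, every mixed side contains the W-vertex of \<open>NW\<close> together with
  the E-vertex of \<open>NE\<close>, or that of \<open>SW\<close> together with that of \<open>SE\<close>. This is preserved by cuts, and two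
  such pairs cannot meet three disjoint mixed sides. Conversely, if no vertex has three mixed branches,
  then two such pairs exist, and for any choice of them the tree can be taken apart at an arbitrary
  edge between inner vertices: the pairs restrict to both halves, after a suitable choice of the
  distinguished vertices that are lost.\<close>

section \<open>Splits of oriented trees\<close>

text \<open>The cut rule wants, for each of the two indices, that the cut edge be distinguished on
  at least one side. Realising a tree by some construction is therefore too weak for an induction:
  the distinguished leaves have to be prescribed, and each half must be built with leaves that meet
  the cut condition and recombine to the prescribed ones. Cutting at an edge from \<open>a\<close>
  to \<open>d\<close> gives the western half a fresh sink \<open>b\<close> that stands for all of
  the east, so an E-vertex lost to the east becomes \<open>b\<close>. A lost W-vertex has no such
  substitute, since \<open>b\<close> is no source; it must be chosen anew so that the mixed sides
  which its pair used to serve are still served. This is a Helly-type question about the sides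
  alone, whence the abstraction \<open>split_system\<close>. The cut condition could fail only for a
  pair with its W-vertex in the east and its E-vertex in the west; then both sides of the cut edge
  would be mixed and each would need an index of its own, making three. Only one half is ever
  treated: reversing all arcs exchanges west and east.\<close>

definition adj :: "('a \<times> 'a) set \<Rightarrow> 'a \<Rightarrow> 'a \<Rightarrow> bool" where
  "adj R x y \<longleftrightarrow> (x, y) \<in> R \<or> (y, x) \<in> R"

lemma adj_commute: "adj R x y \<longleftrightarrow> adj R y x"
  by (auto simp: adj_def)

lemma adj_converse [simp]: "adj (R\<inverse>) = adj R"
  by (auto simp: adj_def fun_eq_iff)

text \<open>Connectivity is phrased without walks, so that it is proved and used by closure
  arguments. Walks are needed only where semipaths of the digraph are at stake.\<close>

definition cut_connected :: "'a set \<Rightarrow> ('a \<times> 'a) set \<Rightarrow> bool" where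
  "cut_connected V R \<longleftrightarrow>
     (\<forall>S\<subseteq>V. S \<noteq> {} \<longrightarrow> (\<forall>u v. adj R u v \<longrightarrow> u \<in> S \<longrightarrow> v \<in> S) \<longrightarrow> S = V)"

text \<open>The edge joining \<open>x\<close> and \<open>y\<close> is a bridge, and \<open>S\<close> is the component of \<open>x\<close> left by its removal.\<close>

definition edge_split :: "'a set \<Rightarrow> ('a \<times> 'a) set \<Rightarrow> 'a \<Rightarrow> 'a \<Rightarrow> 'a set \<Rightarrow> bool" where
  "edge_split V R x y S \<longleftrightarrow> adj R x y \<and> S \<subseteq> V \<and> x \<in> S \<and> y \<notin> S \<and>
     (\<forall>u v. adj R u v \<longrightarrow> u \<in> S \<longrightarrow> v \<notin> S \<longrightarrow> u = x \<and> v = y)"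

lemma edge_splitD:
  assumes "edge_split V R x y S"
  shows "adj R x y" "S \<subseteq> V" "x \<in> S" "y \<notin> S"
  using assms unfolding edge_split_def by blast+

lemma edge_split_leave:
  "edge_split V R x y S \<Longrightarrow> adj R u v \<Longrightarrow> u \<in> S \<Longrightarrow> v \<notin> S \<Longrightarrow> u = x \<and> v = y"
  unfolding edge_split_def by blast

definition sources :: "'a set \<Rightarrow> ('a \<times> 'a) set \<Rightarrow> 'a set" where
  "sources V R = {v \<in> V. \<forall>u. (u, v) \<notin> R}"

definition sinks :: "'a set \<Rightarrow> ('a \<times> 'a) set \<Rightarrow> 'a set" where
  "sinks V R = {v \<in> V. \<forall>u. (v, u) \<notin> R}"

lemma sources_converse [simp]: "sources V (R\<inverse>) = sinks V R"
  and sinks_converse [simp]: "sinks V (R\<inverse>) = sources V R"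
  by (auto simp: sources_def sinks_def)

lemma edge_split_converse [simp]: "edge_split V (R\<inverse>) = edge_split V R"
  by (auto simp: edge_split_def fun_eq_iff)

lemma cut_connected_converse [simp]: "cut_connected V (R\<inverse>) = cut_connected V R"
  by (auto simp: cut_connected_def)

definition mixed :: "'a set \<Rightarrow> ('a \<times> 'a) set \<Rightarrow> 'a set \<Rightarrow> bool" where
  "mixed V R S \<longleftrightarrow> S \<inter> sources V R \<noteq> {} \<and> S \<inter> sinks V R \<noteq> {}"

lemma mixed_converse [simp]: "mixed V (R\<inverse>) = mixed V R"
  by (auto simp: mixed_def fun_eq_iff)

lemma mixed_mono: "mixed V R S \<Longrightarrow> S \<subseteq> T \<Longrightarrow> mixed V R T"
  by (auto simp: mixed_def)

text \<open>Acyclicity appears as the property that every edge is a bridge; this form supplies the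
  sides directly and passes easily to composed trees and to halves.\<close>

locale oriented_tree =
  fixes V :: "'a set" and R :: "('a \<times> 'a) set"
  assumes finite_V: "finite V"
    and edges_subset: "R \<subseteq> V \<times> V"
    and antisymmetric: "(x, y) \<in> R \<Longrightarrow> (y, x) \<notin> R"
    and connected: "cut_connected V R"
    and split_exists: "(x, y) \<in> R \<Longrightarrow> \<exists>S. edge_split V R x y S"
begin

text \<open>Reversal exchanges sources and sinks and keeps sides and mixedness, so each later
  statement about sources follows from the one about sinks.\<close>

lemma dual: "oriented_tree V (R\<inverse>)"
proof
  show "finite V" by (rule finite_V)
  show "R\<inverse> \<subseteq> V \<times> V" using edges_subset by auto
  show "(y, x) \<notin> R\<inverse>" if "(x, y) \<in> R\<inverse>" for x y using antisymmetric that by auto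
  show "cut_connected V (R\<inverse>)" using connected by simp
  show "\<exists>S. edge_split V (R\<inverse>) x y S" if xy: "(x, y) \<in> R\<inverse>" for x y
  proof -
    obtain S where S: "edge_split V R y x S" using xy split_exists by auto
    then have "edge_split V R x y (V - S)"
      using edges_subset unfolding edge_split_def adj_def by blast
    then show ?thesis by auto
  qed
qed

lemma adj_in: "adj R x y \<Longrightarrow> x \<in> V \<and> y \<in> V"
  using edges_subset by (auto simp: adj_def)

lemma adj_neq: "adj R x y \<Longrightarrow> x \<noteq> y"
  using antisymmetric by (auto simp: adj_def)

lemma split_compl: "edge_split V R x y S \<Longrightarrow> edge_split V R y x (V - S)"
  using edges_subset unfolding edge_split_def adj_def by blast

lemma split_exists_adj: "adj R x y \<Longrightarrow> \<exists>S. edge_split V R x y S"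
  using split_exists split_compl unfolding adj_def by blast

lemma leaving_edge:
  assumes "S \<subseteq> V" "S \<noteq> {}" "S \<noteq> V"
  obtains u v where "adj R u v" "u \<in> S" "v \<notin> S"
  using connected assms unfolding cut_connected_def by blast

lemma closed_eq:
  assumes "S \<subseteq> V" "x \<in> S" "\<And>u v. adj R u v \<Longrightarrow> u \<in> S \<Longrightarrow> v \<in> S"
  shows "S = V"
  using assms leaving_edge[of S] by (metis empty_iff)

text \<open>If all four corners \<open>S \<inter> T\<close>, \<open>S - T\<close>,
  \<open>T - S\<close> and \<open>V - (S \<union> T)\<close> are nonempty, connectivity makes an
  edge leave each of them, and it can only be one of the two bridges. So each corner holds one of
  the four bridge ends, which puts the ends of a bridge in opposite corners. Such a bridge crosses
  both splits, hence equals the other bridge, a contradiction.\<close>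

lemma split_compatible:
  assumes S: "edge_split V R x y S" and T: "edge_split V R a b T"
  shows "S \<inter> T = {} \<or> S \<subseteq> T \<or> T \<subseteq> S \<or> S \<union> T = V"
proof (rule ccontr)
  note s = edge_splitD[OF S] and t = edge_splitD[OF T]
  assume *: "\<not> ?thesis"
  obtain u v where "adj R u v" "u \<in> S \<inter> T" "v \<notin> S \<inter> T"
    using leaving_edge[of "S \<inter> T"] * s t by blast
  then have 1: "x \<in> T \<or> a \<in> S" using edge_split_leave[OF S] edge_split_leave[OF T] by blast
  obtain u v where "adj R u v" "u \<in> S - T" "v \<notin> S - T"
    using leaving_edge[of "S - T"] * s t by blast
  then have 2: "x \<notin> T \<or> b \<in> S" using edge_split_leave[OF S] edge_split_leave[OF T]
    by (metis DiffD1 DiffD2 DiffI adj_commute)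
  obtain u v where "adj R u v" "u \<in> T - S" "v \<notin> T - S"
    using leaving_edge[of "T - S"] * s t by blast
  then have 3: "a \<notin> S \<or> y \<in> T" using edge_split_leave[OF S] edge_split_leave[OF T]
    by (metis DiffD1 DiffD2 DiffI adj_commute)
  obtain u v where uv: "adj R u v" "u \<in> V - (S \<union> T)" "v \<notin> V - (S \<union> T)"
    using leaving_edge[of "V - (S \<union> T)"] * s t by blast
  then have 4: "y \<notin> T \<or> b \<notin> S" using edge_split_leave[OF S] edge_split_leave[OF T] adj_in
    by (metis DiffD2 DiffI UnCI UnE adj_commute)
  show False
    using 1 2 3 4 s(1,3,4) t(1,3,4) edge_split_leave[OF S, of a b]
      edge_split_leave[OF T, of x y] edge_split_leave[OF S, of b a] edge_split_leave[OF T, of y x]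
    by (metis adj_commute)
qed

text \<open>The vertices on which \<open>S\<close> and \<open>T\<close> agree form a set closed
  under adjacency: membership changes only along the edge between \<open>x\<close> and
  \<open>y\<close>, and there for both sets at once.\<close>

lemma split_unique:
  assumes S: "edge_split V R x y S" and T: "edge_split V R x y T"
  shows "S = T"
proof -
  note s = edge_splitD[OF S] and t = edge_splitD[OF T]
  let ?Z = "{v \<in> V. v \<in> S \<longleftrightarrow> v \<in> T}"
  have "v \<in> ?Z" if uv: "adj R u v" "u \<in> ?Z" for u v
  proof -
    have vu: "adj R v u" "v \<in> V" using uv(1) adj_commute adj_in by metis+
    show ?thesis
      using uv vu s(3,4) t(3,4) edge_split_leave[OF S uv(1)] edge_split_leave[OF T uv(1)]
        edge_split_leave[OF S vu(1)] edge_split_leave[OF T vu(1)] by blast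
  qed
  moreover have "x \<in> ?Z" using s t by auto
  ultimately have "?Z = V" by (intro closed_eq[of ?Z x]) auto
  then have "\<forall>v\<in>V. v \<in> S \<longleftrightarrow> v \<in> T" by (auto simp: set_eq_iff)
  then show ?thesis using s(2) t(2) by blast
qed

lemma branches_disjoint:
  assumes S: "edge_split V R x y S" and T: "edge_split V R z y T" and "x \<noteq> z"
  shows "S \<inter> T = {}"
proof -
  note s = edge_splitD[OF S] and t = edge_splitD[OF T]
  have "\<not> S \<subseteq> T" using s(3) edge_split_leave[OF T s(1) _ t(4)] \<open>x \<noteq> z\<close> by blast
  moreover have "\<not> T \<subseteq> S" using t(3) edge_split_leave[OF S t(1) _ s(4)] \<open>x \<noteq> z\<close> by blast
  moreover have "S \<union> T \<noteq> V" using s(4) t(4) adj_in[OF s(1)] by blast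
  ultimately show ?thesis using split_compatible[OF S T] by blast
qed

text \<open>Going on from \<open>a\<close> without turning back to \<open>b\<close> strictly shrinks
  the side ahead. This is the decreasing measure when a walk is followed towards a leaf.\<close>

lemma split_subset:
  assumes S: "edge_split V R a b S" and T: "edge_split V R c a T" and "c \<noteq> b"
  shows "T \<subset> S"
proof -
  note s = edge_splitD[OF S] and t = edge_splitD[OF T]
  have "adj R b a" "adj R a c" using s(1) t(1) adj_commute by metis+
  then have b: "b \<notin> T" and c: "c \<in> S"
    using edge_split_leave[OF T, of b a] edge_split_leave[OF S, of a c] s(3) t(4) \<open>c \<noteq> b\<close> by blast+
  have "S \<inter> T \<noteq> {}" using c t(3) by blast
  moreover have "\<not> S \<subseteq> T" using s(3) t(4) by blast
  moreover have "S \<union> T \<noteq> V" using s(4) b adj_in[OF s(1)] by blast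
  ultimately show ?thesis using split_compatible[OF S T] by blast
qed

lemma branch_exists:
  assumes "v \<in> V" "y \<in> V" "v \<noteq> y"
  obtains z Z where "edge_split V R z y Z" "v \<in> Z"
proof -
  let ?Z = "insert y {v. \<exists>z Z. edge_split V R z y Z \<and> v \<in> Z}"
  have "?Z \<subseteq> V" using \<open>y \<in> V\<close> edge_splitD(2) by fastforce
  moreover have "v \<in> ?Z" if uv: "adj R u v" "u \<in> ?Z" for u v
  proof (cases "u = y")
    case True
    then obtain Z where "edge_split V R v y Z" using split_exists_adj uv adj_commute by metis
    then show ?thesis using edge_splitD(3) by fast
  next
    case False
    then obtain z Z where "edge_split V R z y Z" "u \<in> Z" using uv by auto
    then show ?thesis using uv edge_split_leave by fast
  qed
  ultimately have "?Z = V" by (intro closed_eq[of ?Z y]) auto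
  then show ?thesis using assms that by blast
qed

text \<open>Arcs are followed forwards from \<open>y\<close>. Antisymmetry forbids returning over
  the arc just used, so the side ahead shrinks until a sink is reached.\<close>

lemma head_side_has_sink:
  assumes "(x, y) \<in> R" "edge_split V R y x S"
  shows "S \<inter> sinks V R \<noteq> {}"
  using assms
proof (induction "card S" arbitrary: x y S rule: less_induct)
  case less
  note s = edge_splitD[OF less(3)]
  show ?case
  proof (cases "y \<in> sinks V R")
    case True
    then show ?thesis using s by auto
  next
    case False
    then obtain z where z: "(y, z) \<in> R" using s by (auto simp: sinks_def)
    then obtain T where T: "edge_split V R z y T" using split_exists_adj by (metis adj_def)
    have "z \<noteq> x" using z less antisymmetric by auto
    then have "T \<subset> S" using split_subset less T by blast
    moreover have "finite S" using s finite_V finite_subset by auto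
    ultimately show ?thesis using less(1)[OF _ z T] psubset_card_mono by blast
  qed
qed

lemma tail_side_has_source:
  assumes "(x, y) \<in> R" "edge_split V R x y S"
  shows "S \<inter> sources V R \<noteq> {}"
proof -
  interpret d: oriented_tree V "R\<inverse>" by (rule dual)
  show ?thesis using d.head_side_has_sink[of y x S] assms by simp
qed

text \<open>Among three disjoint mixed sides choose the first as large as possible. If the other two lay in
  the same branch at the far end of its edge, the complement of that branch would be larger.\<close>

lemma three_mixed_branches:
  assumes "edge_split V R a1 b1 S1" "edge_split V R a2 b2 S2" "edge_split V R a3 b3 S3"
    and "mixed V R S1" "mixed V R S2" "mixed V R S3"
    and "S1 \<inter> S2 = {}" "S1 \<inter> S3 = {}" "S2 \<inter> S3 = {}"
  obtains y x1 x2 x3 T1 T2 T3 where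
    "edge_split V R x1 y T1" "edge_split V R x2 y T2" "edge_split V R x3 y T3"
    "mixed V R T1" "mixed V R T2" "mixed V R T3"
    "x1 \<noteq> x2" "x1 \<noteq> x3" "x2 \<noteq> x3"
  using assms
proof (induction "card V - card S1" arbitrary: a1 b1 S1 thesis rule: less_induct)
  case less
  have nd: "S2 \<noteq> {}" "S3 \<noteq> {}" using less.prems(6,7) by (auto simp: mixed_def)
  \<comment> \<open>If \<open>b1\<close> were in \<open>T\<close>, the edge to \<open>a1\<close>,
    which lies outside \<open>T\<close>, would be the bridge of \<open>T\<close>. Then
    \<open>T\<close> is the complement of \<open>S1\<close>, leaving no room for the third set
    \<open>U\<close>.\<close>
  have out: "b1 \<notin> T" if T: "edge_split V R a b T" "S1 \<inter> T = {}" "T \<inter> U = {}" "U \<noteq> {}" "S1 \<inter> U = {}"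
    "U \<subseteq> V" for a b T U
  proof
    note s = edge_splitD[OF less.prems(2)] and t = edge_splitD[OF T(1)]
    assume b1: "b1 \<in> T"
    then have "a = b1 \<and> b = a1" using T s edge_split_leave[OF T(1), of b1 a1] by (metis IntI adj_commute empty_iff)
    then have "T = V - S1" using split_unique[OF T(1)] split_compl[OF less.prems(2)] by auto
    then show False using T by blast
  qed
  have b1: "b1 \<notin> S1" "b1 \<notin> S2" "b1 \<notin> S3"
    using edge_splitD[OF less.prems(2)] out[OF less.prems(3), of S3] out[OF less.prems(4), of S2]
      less.prems(8-) edge_splitD(2)[OF less.prems(3)] edge_splitD(2)[OF less.prems(4)] nd
    by (simp_all add: Int_commute)
  have b1V: "b1 \<in> V" using edge_splitD(1)[OF less.prems(2)] adj_in by auto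
  \<comment> \<open>A side avoiding \<open>b1\<close> lies in a single branch at \<open>b1\<close>,
    namely the one containing its own bridge end \<open>a\<close>.\<close>
  have branch: "\<exists>z Z. edge_split V R z b1 Z \<and> T \<subseteq> Z"
    if T: "edge_split V R a b T" "b1 \<notin> T" for a b T
  proof -
    note t = edge_splitD[OF T(1)]
    obtain z Z where Z: "edge_split V R z b1 Z" "a \<in> Z"
      using branch_exists[of a b1] t b1V T by auto
    note z = edge_splitD[OF Z(1)]
    have "Z = T" if "Z \<subseteq> T"
      using that edge_split_leave[OF T(1), of z b1] T z Z split_unique by blast
    then show ?thesis using split_compatible[OF T(1) Z(1)] z Z t T b1V by blast
  qed
  obtain z2 Z2 where Z2: "edge_split V R z2 b1 Z2" "S2 \<subseteq> Z2" using branch less.prems(3) b1 by blast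
  obtain z3 Z3 where Z3: "edge_split V R z3 b1 Z3" "S3 \<subseteq> Z3" using branch less.prems(4) b1 by blast
  have ne: "z \<noteq> a1" if "edge_split V R z b1 Z" "U \<subseteq> Z" "S1 \<inter> U = {}" "U \<noteq> {}" for z Z U
    using that split_unique[OF _ less.prems(2)] by blast
  have ne2: "z2 \<noteq> a1" "z3 \<noteq> a1" 
    using ne[OF Z2 less.prems(8) nd(1)] ne[OF Z3 less.prems(9) nd(2)] by auto
  show ?case
  proof (cases "z2 = z3")
    case False
    then show ?thesis
      using less.prems(1)[OF less.prems(2) Z2(1) Z3(1)] less.prems ne2 Z2 Z3 mixed_mono by metis
  next
    case True
    then have Z: "Z2 = Z3" using Z2 Z3 split_unique by blast
    have dj: "S1 \<inter> Z2 = {}" using branches_disjoint[OF less.prems(2) Z2(1)] ne2 by blast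
    have sub: "S1 \<subset> V - Z2"
      using dj edge_splitD[OF less.prems(2)] edge_splitD[OF Z2(1)] b1V by blast
    have "card S1 < card (V - Z2)" using sub finite_V by (simp add: psubset_card_mono)
    moreover have "card (V - Z2) \<le> card V" using finite_V by (simp add: card_mono)
    ultimately have "card V - card (V - Z2) < card V - card S1" by linarith
    moreover have "mixed V R (V - Z2)" using mixed_mono[OF less.prems(5)] sub by blast
    moreover have "(V - Z2) \<inter> S2 = {}" "(V - Z2) \<inter> S3 = {}" using Z Z2(2) Z3(2) by blast+
    ultimately show ?thesis
      using less.hyps[OF _ _ split_compl[OF Z2(1)] less.prems(3,4) _ less.prems(6,7) _ _
          less.prems(10)] less.prems(1) by metis
  qed
qed

end

section \<open>Pairs of points meeting all mixed sets of a split system\<close>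

text \<open>The members of \<open>F\<close> through a fixed \<open>x\<close> form a chain, so one of
  them has the largest trace on \<open>L\<close>. It does not cover \<open>L\<close>, and any point
  of \<open>L\<close> outside it can serve as \<open>y\<close>. If no member contains
  \<open>x\<close>, then \<open>y = x\<close> will do.\<close>

lemma two_points_not_in_laminar:
  assumes "finite L" "L \<noteq> {}" and proper: "\<And>T. T \<in> F \<Longrightarrow> \<not> L \<subseteq> T"
    and laminar: "\<And>S T. S \<in> F \<Longrightarrow> T \<in> F \<Longrightarrow> S \<inter> T = {} \<or> S \<subseteq> T \<or> T \<subseteq> S"
  obtains x y where "x \<in> L" "y \<in> L" "\<And>T. T \<in> F \<Longrightarrow> x \<notin> T \<or> y \<notin> T"
proof -
  obtain x where x: "x \<in> L" using assms by auto
  show ?thesis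
  proof (cases "\<exists>T\<in>F. x \<in> T")
    case False
    then show ?thesis using that x by blast
  next
    case True
    then have "\<exists>T. T \<in> F \<and> x \<in> T" by blast
    moreover have "\<forall>T. T \<in> F \<and> x \<in> T \<longrightarrow> card (T \<inter> L) < Suc (card L)"
      using assms(1) by (simp add: card_mono less_Suc_eq_le)
    ultimately obtain T where T: "T \<in> F" "x \<in> T"
      and max: "\<And>S. S \<in> F \<and> x \<in> S \<Longrightarrow> card (S \<inter> L) \<le> card (T \<inter> L)"
      using ex_has_greatest_nat[of "\<lambda>T. T \<in> F \<and> x \<in> T" _ "\<lambda>T. card (T \<inter> L)" "Suc (card L)"] by metis
    obtain y where y: "y \<in> L" "y \<notin> T" using proper T by blast
    have "y \<notin> S" if S: "S \<in> F" "x \<in> S" for S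
    proof
      assume "y \<in> S"
      then have "T \<subseteq> S" using laminar[of S T] S T y by blast
      then have "T \<inter> L \<subset> S \<inter> L" using y \<open>y \<in> S\<close> by blast
      then have "card (T \<inter> L) < card (S \<inter> L)" using assms(1) by (simp add: psubset_card_mono)
      then show False using max[of S] S by simp
    qed
    then show ?thesis using that[OF x y(1)] by blast
  qed
qed

text \<open>\<open>F\<close> plays the role of the set of all sides of edges of a tree, \<open>W\<close> and \<open>E\<close> those of its sources
  and sinks, and \<open>bi\<close> means mixed.\<close>

locale split_system =
  fixes V :: "'a set" and F :: "'a set set" and W E :: "'a set"
  assumes finite_V: "finite V"
    and F_subset: "S \<in> F \<Longrightarrow> S \<subseteq> V"
    and compl: "S \<in> F \<Longrightarrow> V - S \<in> F"
    and compatible: "S \<in> F \<Longrightarrow> T \<in> F \<Longrightarrow> S \<inter> T = {} \<or> S \<subseteq> T \<or> T \<subseteq> S \<or> S \<union> T = V"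
    and W_subset: "W \<subseteq> V" and E_subset: "E \<subseteq> V" and W_ne: "W \<noteq> {}" and E_ne: "E \<noteq> {}"
begin

lemma finite_W: "finite W"
  using W_subset finite_V finite_subset by blast

lemma finite_E: "finite E"
  using E_subset finite_V finite_subset by blast

definition bi :: "'a set \<Rightarrow> bool" where
  "bi S \<longleftrightarrow> S \<in> F \<and> S \<inter> W \<noteq> {} \<and> S \<inter> E \<noteq> {}"

text \<open>Among the mixed sets not containing both \<open>s\<close> and \<open>t\<close>, one that minimises \<open>card (S \<inter> W)\<close> has its
  whole trace on \<open>W\<close> contained in all the others.\<close>

lemma pair_extension:
  assumes "b \<in> E" "t \<in> E" "s \<in> W"
    and avoid: "\<And>S. bi S \<Longrightarrow> b \<notin> S \<Longrightarrow> s \<in> S \<and> t \<in> S"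
  obtains w where "w \<in> W" "\<And>S. bi S \<Longrightarrow> (w \<in> S \<and> b \<in> S) \<or> (s \<in> S \<and> t \<in> S)"
proof -
  define bad where "bad S \<longleftrightarrow> bi S \<and> \<not> (s \<in> S \<and> t \<in> S)" for S
  show ?thesis
  proof (cases "\<exists>S. bad S")
    case False
    then show ?thesis using that W_ne unfolding bad_def by blast
  next
    case True
    then obtain S where S: "bad S" and min: "\<And>T. bad T \<Longrightarrow> card (S \<inter> W) \<le> card (T \<inter> W)"
      using ex_has_least_nat[of bad _ "\<lambda>S. card (S \<inter> W)"] by metis
    have le: "S \<inter> W \<subseteq> T" if T: "bad T" for T
    proof -
      have b: "b \<in> S" "b \<in> T" using S T avoid unfolding bad_def by auto
      have F: "S \<in> F" "T \<in> F" using S T unfolding bad_def bi_def by auto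
      have eq: "S \<inter> W = T \<inter> W" if "T \<inter> W \<subseteq> S"
        using that min[OF T] finite_W card_subset_eq[of "S \<inter> W" "T \<inter> W"]
        by (metis Int_lower2 card_seteq finite_Int inf.boundedI)
      consider "S \<subseteq> T" | "T \<subseteq> S" | "S \<union> T = V" using compatible[OF F] b by blast
      then show ?thesis
      proof cases
        case 3
        \<comment> \<open>A mixed \<open>V - S\<close> would omit \<open>b\<close> and hence contain
          \<open>s\<close> and \<open>t\<close>; as \<open>V - S\<close> is contained in
          \<open>T\<close>, so would \<open>T\<close>, against \<open>bad T\<close>. The same holds
          with \<open>S\<close> and \<open>T\<close> exchanged.\<close>
        have nb: "\<not> bi (V - S)"
          using avoid[of "V - S"] b 3 T unfolding bad_def by blast
        have nb': "\<not> bi (V - T)"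
          using avoid[of "V - T"] b 3 S unfolding bad_def by blast
        show ?thesis
        proof (cases "W \<subseteq> S")
          case True
          then show ?thesis using eq by blast
        next
          case False
          \<comment> \<open>Since \<open>V - S\<close> meets \<open>W\<close> and is not mixed, it
            misses \<open>E\<close>. So \<open>t\<close> is in \<open>S\<close>, and badness of
            \<open>S\<close> puts \<open>s\<close> outside \<open>S\<close>, hence in
            \<open>T\<close>; badness of \<open>T\<close> then puts \<open>t\<close> outside
            \<open>T\<close>. Now \<open>V - T\<close> meets \<open>E\<close>, and as it is not
            mixed either, it misses \<open>W\<close>.\<close>
          then have "E \<subseteq> S" using nb compl[OF F(1)] W_subset E_subset unfolding bi_def by blast
          then have "s \<notin> S" using S assms(2) unfolding bad_def by blast
          then have "t \<notin> T" using 3 T assms W_subset unfolding bad_def by blast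
          then have "W \<subseteq> T"
            using nb' compl[OF F(2)] W_subset E_subset assms(2) unfolding bi_def by blast
          then show ?thesis by blast
        qed
      qed (use eq in auto)
    qed
    obtain w where "w \<in> S \<inter> W" using S unfolding bad_def bi_def by auto
    then show ?thesis using that[of w] le avoid unfolding bad_def by blast
  qed
qed

text \<open>If two mixed sets are disjoint, every mixed set contains one of two disjoint minimal ones, which
  supply the pairs. Otherwise the complements of the mixed sets are laminar, and each of them misses
  \<open>W\<close> or misses \<open>E\<close>.\<close>

lemma two_pairs:
  assumes no3: "\<And>S T U. bi S \<Longrightarrow> bi T \<Longrightarrow> bi U \<Longrightarrow> S \<inter> T = {} \<Longrightarrow> S \<inter> U = {} \<Longrightarrow> T \<inter> U \<noteq> {}"
  obtains w e :: "ns \<Rightarrow> 'a" where "\<And>Y. w Y \<in> W" "\<And>Y. e Y \<in> E"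
    "\<And>S. bi S \<Longrightarrow> \<exists>Y. w Y \<in> S \<and> e Y \<in> S"
proof -
  note main = that
  have build: thesis
    if w: "w1 \<in> W" "w2 \<in> W" and e: "e1 \<in> E" "e2 \<in> E"
      and hit: "\<And>S. bi S \<Longrightarrow> (w1 \<in> S \<and> e1 \<in> S) \<or> (w2 \<in> S \<and> e2 \<in> S)" for w1 w2 e1 e2
  proof (rule main[of "case_ns w1 w2" "case_ns e1 e2"])
    show "case_ns w1 w2 Y \<in> W" "case_ns e1 e2 Y \<in> E" for Y
      using w e by (cases Y; simp)+
    show "\<exists>Y. case_ns w1 w2 Y \<in> S \<and> case_ns e1 e2 Y \<in> S" if "bi S" for S
      using hit[OF that] by (metis ns.case)
  qed
  have minimal: "\<exists>S. bi S \<and> S \<subseteq> S0 \<and> (\<forall>T. bi T \<longrightarrow> T \<subseteq> S \<longrightarrow> T = S)" if S0: "bi S0" for S0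
  proof -
    obtain S where S: "bi S \<and> S \<subseteq> S0" and m: "\<And>T. bi T \<and> T \<subseteq> S0 \<Longrightarrow> card S \<le> card T"
      using ex_has_least_nat[of "\<lambda>S. bi S \<and> S \<subseteq> S0" S0 card] S0 by auto
    have "T = S" if "bi T" "T \<subseteq> S" for T
      using that m[of T] S card_seteq[of S T] finite_V F_subset finite_subset
      unfolding bi_def by (meson subset_trans)
    then show ?thesis using S by blast
  qed
  show ?thesis
  proof (cases "\<exists>S T. bi S \<and> bi T \<and> S \<inter> T = {}")
    case True
    then obtain S0 T0 where "bi S0" "bi T0" and dj0: "S0 \<inter> T0 = {}" by blast
    obtain S where S: "bi S" "S \<subseteq> S0" "\<And>T. bi T \<Longrightarrow> T \<subseteq> S \<Longrightarrow> T = S"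
      using minimal[OF \<open>bi S0\<close>] by auto
    obtain T where T: "bi T" "T \<subseteq> T0" "\<And>S. bi S \<Longrightarrow> S \<subseteq> T \<Longrightarrow> S = T"
      using minimal[OF \<open>bi T0\<close>] by auto
    have dj: "S \<inter> T = {}" using S T dj0 by blast
    have F: "S \<in> F" "T \<in> F" using S T unfolding bi_def by auto
    obtain w1 e1 w2 e2 where p: "w1 \<in> S \<inter> W" "e1 \<in> S \<inter> E" "w2 \<in> T \<inter> W" "e2 \<in> T \<inter> E"
      using S T unfolding bi_def by blast
    have "S \<subseteq> U \<or> T \<subseteq> U" if U: "bi U" for U
    proof -
      have UF: "U \<in> F" using U unfolding bi_def by auto
      consider "U \<inter> S \<noteq> {}" | "U \<inter> T \<noteq> {}" using no3[OF S(1) T(1) U dj] by blast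
      then show ?thesis
      proof cases
        case 1
        \<comment> \<open>The alternative that \<open>U\<close> is contained in \<open>S\<close>
          collapses to \<open>U = S\<close> by minimality. If the union is \<open>V\<close>, then
          \<open>T\<close>, being disjoint from \<open>S\<close>, lies in \<open>U\<close>.\<close>
        then have "S \<subseteq> U \<or> S \<union> U = V" using compatible[OF F(1) UF] S(3)[OF U] by blast
        then show ?thesis using dj F_subset[OF F(2)] by blast
      next
        case 2
        then have "T \<subseteq> U \<or> T \<union> U = V" using compatible[OF F(2) UF] T(3)[OF U] by blast
        then show ?thesis using dj F_subset[OF F(1)] by blast
      qed
    qed
    then show ?thesis by (intro build[of w1 w2 e1 e2]) (use p in blast)+
  next
    case False
    define H where "H = {V - S | S. bi S}"
    have lam: "S \<inter> T = {} \<or> S \<subseteq> T \<or> T \<subseteq> S" if ST: "S \<in> H" "T \<in> H" for S T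
    proof -
      obtain S' T' where "S = V - S'" "T = V - T'" "bi S'" "bi T'" using ST unfolding H_def by auto
      moreover then have "S' \<inter> T' \<noteq> {}" using False by blast
      ultimately show ?thesis using compatible[of S' T'] F_subset unfolding bi_def by blast
    qed
    have proper: "\<not> W \<subseteq> T" "\<not> E \<subseteq> T" if "T \<in> H" for T
      using that W_subset E_subset unfolding H_def bi_def by blast+
    obtain w1 w2 where w: "w1 \<in> W" "w2 \<in> W" "\<And>T. T \<in> H \<Longrightarrow> w1 \<notin> T \<or> w2 \<notin> T"
      using two_points_not_in_laminar[of W H thesis] finite_W W_ne proper(1) lam by blast
    obtain e1 e2 where e: "e1 \<in> E" "e2 \<in> E" "\<And>T. T \<in> H \<Longrightarrow> e1 \<notin> T \<or> e2 \<notin> T"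
      using two_points_not_in_laminar[of E H thesis] finite_E E_ne proper(2) lam by blast
    have "(w1 \<in> S \<and> e1 \<in> S) \<or> (w2 \<in> S \<and> e2 \<in> S)" if S: "bi S" for S
    proof -
      have "V - S \<in> H" using S unfolding H_def by auto
      then have h: "w1 \<in> S \<or> w2 \<in> S" "e1 \<in> S \<or> e2 \<in> S"
        using w(1,2) w(3)[of "V - S"] e(1,2) e(3)[of "V - S"] W_subset E_subset by auto
      \<comment> \<open>As \<open>V - S\<close> is not mixed, \<open>S\<close> contains all of
        \<open>W\<close> or all of \<open>E\<close>. In one colour both chosen points are thus in
        \<open>S\<close>, and the index can be taken from the other colour.\<close>
      have "\<not> bi (V - S)" using False S by blast
      then have "W \<subseteq> S \<or> E \<subseteq> S" using S compl W_subset E_subset unfolding bi_def by blast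
      then show ?thesis using h w(1,2) e(1,2) by blast
    qed
    then show ?thesis using build[OF w(1,2) e(1,2)] by blast
  qed
qed

end

section \<open>Cutting and composing trees\<close>

locale WE_tree = oriented_tree +
  assumes source_functional: "v \<in> sources V R \<Longrightarrow> (v, x) \<in> R \<Longrightarrow> (v, y) \<in> R \<Longrightarrow> x = y"
    and sink_functional: "v \<in> sinks V R \<Longrightarrow> (x, v) \<in> R \<Longrightarrow> (y, v) \<in> R \<Longrightarrow> x = y"
    and inner: "\<exists>v\<in>V. v \<notin> sources V R \<and> v \<notin> sinks V R"
begin

lemma dual_WE: "WE_tree V (R\<inverse>)"
proof -
  interpret d: oriented_tree V "R\<inverse>" by (rule dual)
  show ?thesis
    by unfold_locales (use source_functional sink_functional inner in auto)
qed

lemma source_has_edge: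
  assumes "v \<in> sources V R" obtains x where "(v, x) \<in> R"
proof -
  have "v \<in> V" "\<And>u. (u, v) \<notin> R" using assms by (auto simp: sources_def)
  then have "{v} = V" if "\<And>x. (v, x) \<notin> R"
    using that by (intro closed_eq[of "{v}" v]) (auto simp: adj_def)
  then show ?thesis using inner assms that by blast
qed

text \<open>A source and a sink joined by an arc have, by functionality, no further neighbours. They
  would be the whole tree, which then has no inner vertex.\<close>

lemma source_edge_not_sink:
  assumes "a \<in> sources V R" "(a, b) \<in> R"
  shows "b \<notin> sinks V R"
proof
  assume b: "b \<in> sinks V R"
  have "{a, b} = V"
  proof (rule closed_eq[of "{a, b}" a])
    show "{a, b} \<subseteq> V" using edges_subset assms by auto
    show "v \<in> {a, b}" if "adj R u v" "u \<in> {a, b}" for u v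
      using that assms b source_functional[OF assms] sink_functional[OF b assms(2)]
      unfolding adj_def sources_def sinks_def by blast
  qed simp
  then show False using inner assms b by blast
qed

lemma sources_sinks_disjoint: "sources V R \<inter> sinks V R = {}"
  using source_has_edge unfolding sinks_def by blast

lemma sources_subset: "sources V R \<subseteq> V" and sinks_subset: "sinks V R \<subseteq> V"
  by (auto simp: sources_def sinks_def)

end

text \<open>\<open>w Y\<close> and \<open>e Y\<close> stand for the W-vertex of \<open>YW\<close> and the E-vertex of \<open>YE\<close>; since W-edges and E-edges are
  functional, these vertices determine the distinguished edges. That \<open>w North \<noteq> w South\<close> when there are
  two sources follows by taking the complement of the leaf \<open>w North\<close> as the mixed side.\<close>

definition marking :: "'a set \<Rightarrow> ('a \<times> 'a) set \<Rightarrow> (ns \<Rightarrow> 'a) \<Rightarrow> (ns \<Rightarrow> 'a) \<Rightarrow> bool" where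
  "marking V R w e \<longleftrightarrow> (\<forall>Y. w Y \<in> sources V R \<and> e Y \<in> sinks V R) \<and>
     (\<forall>x y S. edge_split V R x y S \<longrightarrow> mixed V R S \<longrightarrow> (\<exists>Y. w Y \<in> S \<and> e Y \<in> S))"

lemma markingD:
  assumes "marking V R w e"
  shows "w Y \<in> sources V R" "e Y \<in> sinks V R"
    and "edge_split V R x y S \<Longrightarrow> mixed V R S \<Longrightarrow> \<exists>Y. w Y \<in> S \<and> e Y \<in> S"
  using assms unfolding marking_def by blast+

lemma marking_converse [simp]: "marking V (R\<inverse>) w e \<longleftrightarrow> marking V R e w"
  unfolding marking_def by (simp add: conj_commute)

section \<open>Composition of two marked trees\<close>

locale tree_cut = W: WE_tree V1 R1 + E: WE_tree V2 R2 for V1 R1 V2 R2 +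
  fixes a b c d :: 'a
  assumes ab: "(a, b) \<in> R1" and b_sink: "b \<in> sinks V1 R1"
    and cd: "(c, d) \<in> R2" and c_source: "c \<in> sources V2 R2"
    and disjoint: "V1 \<inter> V2 = {}"
begin

definition V where "V = (V1 \<union> V2) - {b, c}"
definition R where "R = (R1 - {(a, b)}) \<union> (R2 - {(c, d)}) \<union> {(a, d)}"

text \<open>Reversing all arcs also exchanges the two trees, so facts about the western tree inside
  the composed tree transfer to the eastern one.\<close>

lemma dual_cut: "tree_cut V2 (R2\<inverse>) V1 (R1\<inverse>) d c b a"
  using W.dual_WE E.dual_WE ab b_sink cd c_source disjoint
  by (auto simp: tree_cut_def tree_cut_axioms_def)

lemma dual_V: "tree_cut.V V2 V1 c b = V"
  unfolding tree_cut.V_def[OF dual_cut] V_def by auto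

lemma dual_R: "tree_cut.R (R2\<inverse>) (R1\<inverse>) d c b a = R\<inverse>"
  unfolding tree_cut.R_def[OF dual_cut] R_def by auto

lemma verts: "a \<in> V1" "b \<in> V1" "c \<in> V2" "d \<in> V2" "a \<noteq> b" "c \<noteq> d" "V1 \<inter> V2 = {}"
  using ab cd W.edges_subset E.edges_subset W.adj_neq[of a b] E.adj_neq[of c d] disjoint
  by (auto simp: adj_def)

lemma ne: "a \<noteq> c" "a \<noteq> d" "b \<noteq> c" "b \<noteq> d" "a \<notin> V2" "b \<notin> V2" "c \<notin> V1" "d \<notin> V1"
  using verts by auto

lemma R1_in: "(u, v) \<in> R1 \<Longrightarrow> u \<in> V1 \<and> v \<in> V1 \<and> u \<notin> V2 \<and> v \<notin> V2 \<and> u \<noteq> c \<and> v \<noteq> c"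
  and R2_in: "(u, v) \<in> R2 \<Longrightarrow> u \<in> V2 \<and> v \<in> V2 \<and> u \<notin> V1 \<and> v \<notin> V1 \<and> u \<noteq> b \<and> v \<noteq> b"
  using W.edges_subset E.edges_subset verts by blast+

lemma b_adj: "adj R1 b v \<longleftrightarrow> v = a" "adj R1 v b \<longleftrightarrow> v = a"
  using ab b_sink W.sink_functional[OF b_sink ab] unfolding adj_def sinks_def by blast+

lemma c_adj: "adj R2 c v \<longleftrightarrow> v = d" "adj R2 v c \<longleftrightarrow> v = d"
  using cd c_source E.source_functional[OF c_source cd] unfolding adj_def sources_def by blast+

lemma R1_b: "(b, v) \<notin> R1" "(v, b) \<in> R1 \<longleftrightarrow> v = a"
  using ab b_sink W.sink_functional[OF b_sink ab] unfolding sinks_def by blast+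

lemma R2_c: "(v, c) \<notin> R2" "(c, v) \<in> R2 \<longleftrightarrow> v = d"
  using cd c_source E.source_functional[OF c_source cd] unfolding sources_def by blast+

lemma R_iff: "(u, v) \<in> R \<longleftrightarrow> ((u, v) \<in> R1 \<and> v \<noteq> b) \<or> ((u, v) \<in> R2 \<and> u \<noteq> c) \<or> (u = a \<and> v = d)"
  using R1_b R2_c by (auto simp: R_def)

lemma adj_iff: "adj R u v \<longleftrightarrow> (adj R1 u v \<and> u \<noteq> b \<and> v \<noteq> b) \<or> (adj R2 u v \<and> u \<noteq> c \<and> v \<noteq> c) \<or>
    (u = a \<and> v = d) \<or> (u = d \<and> v = a)"
  using R1_b R2_c by (auto simp: adj_def R_iff)

lemma R_subset: "R \<subseteq> V \<times> V"
  using R1_b R2_c verts ne by (auto simp: R_iff V_def dest: R1_in R2_in)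

lemma R_antisymmetric: "(x, y) \<in> R \<Longrightarrow> (y, x) \<notin> R"
  using W.antisymmetric E.antisymmetric ne by (auto simp: R_iff dest: R1_in R2_in)

lemma sources_eq: "sources V R = sources V1 R1 \<union> (sources V2 R2 - {c})"
proof (intro set_eqI iffI)
  fix v assume "v \<in> sources V R"
  then have v: "v \<in> V" "\<And>u. (u, v) \<notin> R" by (auto simp: sources_def)
  then have "v \<noteq> d" "v \<noteq> b" "v \<noteq> c" by (auto simp: R_iff V_def)
  then have "(u, v) \<notin> R1" "(u, v) \<notin> R2" for u using v(2)[of u] R2_c(2)[of v] by (auto simp: R_iff)
  then show "v \<in> sources V1 R1 \<union> (sources V2 R2 - {c})"
    using v(1) by (auto simp: sources_def V_def)
next
  fix v assume v: "v \<in> sources V1 R1 \<union> (sources V2 R2 - {c})"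
  then have "v \<noteq> b" "v \<noteq> d" using ab cd ne by (auto simp: sources_def)
  moreover have "(u, v) \<notin> R1" "(u, v) \<notin> R2" for u
    using v by (auto simp: sources_def dest: R1_in R2_in)
  ultimately show "v \<in> sources V R"
    using v ne by (auto simp: sources_def R_iff V_def)
qed

lemma sinks_eq: "sinks V R = (sinks V1 R1 - {b}) \<union> sinks V2 R2"
  using tree_cut.sources_eq[OF dual_cut] unfolding dual_V dual_R by auto

lemma connected_cut: "cut_connected V R"
  unfolding cut_connected_def
proof (intro allI impI)
  fix S assume S: "S \<subseteq> V" "S \<noteq> {}" and cl: "\<forall>u v. adj R u v \<longrightarrow> u \<in> S \<longrightarrow> v \<in> S"
  have ad: "a \<in> S \<longleftrightarrow> d \<in> S" using cl adj_iff by blast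
  \<comment> \<open>The omitted leaf \<open>b\<close> follows its neighbour \<open>a\<close>, and
    \<open>c\<close> follows \<open>d\<close>, which is in \<open>S\<close> exactly when
    \<open>a\<close> is. With these additions both traces are closed in their own trees.\<close>
  define S1 where "S1 = S \<inter> V1 \<union> (if a \<in> S then {b} else {})"
  define S2 where "S2 = S \<inter> V2 \<union> (if a \<in> S then {c} else {})"
  have bc: "b \<notin> S" "c \<notin> S" using S by (auto simp: V_def)
  have 1: "S1 = V1" if "s \<in> S1" for s
  proof (rule W.closed_eq[OF _ that])
    show "S1 \<subseteq> V1" using verts by (auto simp: S1_def)
    show "v \<in> S1" if "adj R1 u v" "u \<in> S1" for u v
      using that cl W.adj_in[OF that(1)] adj_iff[of u v] b_adj bc by (auto simp: S1_def split: if_splits)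
  qed
  have 2: "S2 = V2" if "s \<in> S2" for s
  proof (rule E.closed_eq[OF _ that])
    show "S2 \<subseteq> V2" using verts by (auto simp: S2_def)
    show "v \<in> S2" if "adj R2 u v" "u \<in> S2" for u v
      using that cl E.adj_in[OF that(1)] adj_iff[of u v] c_adj bc ad by (auto simp: S2_def split: if_splits)
  qed
  obtain s where "s \<in> S1 \<or> s \<in> S2" using S by (auto simp: S1_def S2_def V_def)
  then have "a \<in> S1 \<or> d \<in> S2" using 1 2 verts by blast
  then have "a \<in> S" using ad verts by (auto simp: S1_def S2_def split: if_splits)
  then have "a \<in> S1" "c \<in> S2" using verts by (auto simp: S1_def S2_def)
  then have "S1 = V1" "S2 = V2" using 1 2 by blast+
  then show "S = V" using S bc by (auto simp: S1_def S2_def V_def split: if_splits)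
qed

text \<open>The side in the composed tree that comes from the side \<open>S\<close> of an edge of the western tree.\<close>

definition lift :: "'a set \<Rightarrow> 'a set" where
  "lift S = (S - {b}) \<union> (if b \<in> S then V2 - {c} else {})"

lemma lift_W: "v \<in> V1 \<Longrightarrow> v \<in> lift S \<longleftrightarrow> v \<in> S \<and> v \<noteq> b"
  and lift_E: "v \<in> V2 \<Longrightarrow> S \<subseteq> V1 \<Longrightarrow> v \<in> lift S \<longleftrightarrow> b \<in> S \<and> v \<noteq> c"
  using disjoint unfolding lift_def by auto

text \<open>The bridge is not the edge at \<open>b\<close>, so \<open>a\<close> and \<open>b\<close>
  are on the same side. Hence neither the new edge from \<open>a\<close> to \<open>d\<close> nor an
  edge of the eastern tree, which is wholly inside or wholly outside, leaves the lift.\<close>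

lemma lift_split:
  assumes S: "edge_split V1 R1 x y S" and xy: "x \<noteq> b" "y \<noteq> b"
  shows "edge_split V R x y (lift S)"
proof -
  note s = edge_splitD[OF S] and leave = edge_split_leave[OF S]
  have xyV: "x \<in> V1" "y \<in> V1" using W.adj_in s(1) by auto
  have ab': "a \<in> S \<longleftrightarrow> b \<in> S" using leave[of a b] leave[of b a] b_adj xy by blast
  show ?thesis
    unfolding edge_split_def
  proof (intro conjI allI impI)
    show "adj R x y" using s xy by (simp add: adj_iff)
    show "lift S \<subseteq> V" using s verts by (auto simp: lift_def V_def)
    show "x \<in> lift S" "y \<notin> lift S" using s xy lift_W xyV by blast+
    fix u v assume uv: "adj R u v" "u \<in> lift S" "v \<notin> lift S"
    consider "adj R1 u v" "u \<noteq> b" "v \<noteq> b" | "adj R2 u v" "u \<noteq> c" "v \<noteq> c" | "u = a" "v = d" | "u = d" "v = a"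
      using uv(1) unfolding adj_iff by blast
    then have "u = x \<and> v = y"
    proof cases
      case 1
      then have "u \<in> S" "v \<notin> S" using uv lift_W W.adj_in by blast+
      then show ?thesis using leave 1 by blast
    next
      case 2
      then have "u \<in> V2" "v \<in> V2" using E.adj_in by blast+
      then show ?thesis using uv 2 lift_E[OF _ s(2)] by blast
    next
      case 3
      then show ?thesis using uv lift_W[of a] lift_E[OF _ s(2), of d] verts ab' by blast
    next
      case 4
      then show ?thesis using uv lift_W[of a] lift_E[OF _ s(2), of d] verts ab' by blast
    qed
    then show "u = x" "v = y" by auto
  qed
qed

lemma cut_split: "edge_split V R a d (V1 - {b})"
  using verts W.adj_in E.adj_in by (auto simp: edge_split_def adj_iff V_def)

lemma split_exists_W:
  assumes "adj R1 x y" "x \<noteq> b" "y \<noteq> b"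
  shows "\<exists>S. edge_split V R x y S"
  using W.split_exists_adj lift_split assms by blast

lemma oriented_tree_cut: "oriented_tree V R"
proof
  show "finite V" using W.finite_V E.finite_V by (auto simp: V_def)
  show "R \<subseteq> V \<times> V" by (rule R_subset)
  show "(y, x) \<notin> R" if "(x, y) \<in> R" for x y using R_antisymmetric that .
  show "cut_connected V R" by (rule connected_cut)
  show "\<exists>S. edge_split V R x y S" if xy: "(x, y) \<in> R" for x y
  proof -
    consider "adj R1 x y" "x \<noteq> b" "y \<noteq> b" | "adj R2 x y" "x \<noteq> c" "y \<noteq> c" | "x = a" "y = d"
      using xy R1_b R2_c by (auto simp: adj_def R_iff)
    then show ?thesis
    proof cases
      case 1
      then show ?thesis using split_exists_W by blast
    next
      case 2
      then show ?thesis
        using tree_cut.split_exists_W[OF dual_cut] unfolding dual_V dual_R by auto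
    next
      case 3
      then show ?thesis using cut_split by blast
    qed
  qed
qed

lemma WE_tree_cut: "WE_tree V R"
proof -
  interpret o: oriented_tree V R by (rule oriented_tree_cut)
  \<comment> \<open>The new edge joins two inner vertices, so it adds no arc at a source or a
    sink.\<close>
  have na: "a \<notin> sources V1 R1" and nd: "d \<notin> sinks V2 R2"
    using W.source_edge_not_sink ab b_sink E.source_edge_not_sink cd c_source by blast+
  show ?thesis
  proof
    show "x = y" if v: "v \<in> sources V R" and xy: "(v, x) \<in> R" "(v, y) \<in> R" for v x y
      using v xy na W.source_functional E.source_functional W.edges_subset E.edges_subset verts
        W.sources_subset E.sources_subset
      unfolding sources_eq R_iff by blast
    show "x = y" if v: "v \<in> sinks V R" and xy: "(x, v) \<in> R" "(y, v) \<in> R" for v x y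
      using v xy nd W.sink_functional E.sink_functional W.edges_subset E.edges_subset verts
        W.sinks_subset E.sinks_subset
      unfolding sinks_eq R_iff by blast
    obtain v where v: "v \<in> V1" "v \<notin> sources V1 R1" "v \<notin> sinks V1 R1" using W.inner by blast
    then have "v \<notin> V2" "v \<noteq> b" "v \<noteq> c" using verts b_sink by auto
    then have "v \<in> V" "v \<notin> sources V R" "v \<notin> sinks V R"
      using v E.sources_subset E.sinks_subset unfolding sources_eq sinks_eq by (auto simp: V_def)
    then show "\<exists>v\<in>V. v \<notin> sources V R \<and> v \<notin> sinks V R" by blast
  qed
qed

context
  fixes w1 e1 w2 e2 w e :: "ns \<Rightarrow> 'a"
  assumes m1: "marking V1 R1 w1 e1" and m2: "marking V2 R2 w2 e2"
    and extremal: "\<And>Y. e1 Y = b \<or> w2 Y = c"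
    and w_def: "\<And>Y. w Y = (if w2 Y = c then w1 Y else w2 Y)"
    and e_def: "\<And>Y. e Y = (if e1 Y = b then e2 Y else e1 Y)"
begin

lemma mark_in:
  "w1 Y \<in> V1" "w1 Y \<noteq> b" "w1 Y \<in> sources V1 R1" "e2 Y \<in> V2" "e2 Y \<noteq> c" "e2 Y \<in> sinks V2 R2"
  "w2 Y \<in> V2" "e1 Y \<in> V1"
proof -
  show "w1 Y \<in> sources V1 R1" "e2 Y \<in> sinks V2 R2" using markingD(1)[OF m1] markingD(2)[OF m2] .
  then show "w1 Y \<in> V1" "w1 Y \<noteq> b" "e2 Y \<in> V2" "e2 Y \<noteq> c"
    using W.sources_subset E.sinks_subset b_sink c_source W.sources_sinks_disjoint
      E.sources_sinks_disjoint by blast+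
  show "w2 Y \<in> V2" "e1 Y \<in> V1"
    using markingD(1)[OF m2] markingD(2)[OF m1] E.sources_subset W.sinks_subset by blast+
qed

text \<open>If \<open>S\<close> is mixed, take its index \<open>Y\<close>: for \<open>b\<close> in
  \<open>S\<close> the lift contains the whole remaining east, so an exchanged mark is still inside;
  otherwise \<open>e1 Y\<close> is not \<open>b\<close>, and the cut condition forces
  \<open>w2 Y = c\<close>, so both western marks are kept. If \<open>S\<close> is not mixed, it
  contains the sink \<open>b\<close> and no source, so the source in the lift is eastern and
  \<open>V2 - {c}\<close> is mixed. Its index has \<open>w2 Y\<close> different from
  \<open>c\<close>, whence \<open>e1 Y = b\<close>, and both marks are eastern.\<close>

lemma marks_lift:
  assumes S: "edge_split V1 R1 x y S" and xy: "x \<noteq> b" "y \<noteq> b" and mix: "mixed V R (lift S)"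
  shows "\<exists>Y. w Y \<in> lift S \<and> e Y \<in> lift S"
proof (cases "mixed V1 R1 S")
  case True
  then obtain Y where Y: "w1 Y \<in> S" "e1 Y \<in> S" using markingD(3)[OF m1 S] by blast
  show ?thesis
  proof (cases "b \<in> S")
    case True
    then show ?thesis using Y mark_in by (intro exI[of _ Y]) (auto simp: lift_def w_def e_def)
  next
    case False
    then have "e1 Y \<noteq> b" using Y by auto
    then have "w2 Y = c" using extremal by auto
    then show ?thesis
      using Y mark_in \<open>e1 Y \<noteq> b\<close> by (intro exI[of _ Y]) (auto simp: lift_def w_def e_def)
  qed
next
  case False
  have "S \<inter> V2 = {}" using edge_splitD(2)[OF S] verts by blast
  then have b: "b \<in> S" and S0: "S \<inter> sources V1 R1 = {}"
    using mix False b_sink E.sources_subset E.sinks_subset edge_splitD(2)[OF S]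
    unfolding mixed_def sources_eq sinks_eq lift_def by (auto split: if_splits)
  obtain s where "s \<in> sources V2 R2" "s \<noteq> c"
    using mix S0 W.sources_subset verts unfolding mixed_def sources_eq lift_def
    by (auto split: if_splits)
  then have "mixed V2 R2 (V2 - {c})"
    using E.sources_subset mark_in(4-6) unfolding mixed_def by blast
  moreover have "edge_split V2 R2 d c (V2 - {c})"
    using verts E.adj_in c_adj by (auto simp: edge_split_def)
  ultimately obtain Y where "w2 Y \<in> V2 - {c}" using markingD(3)[OF m2] by blast
  then have Y: "w2 Y \<noteq> c" "e1 Y = b" using extremal by auto
  then show ?thesis
    using b mark_in(4,5,7) by (intro exI[of _ Y]) (auto simp: lift_def w_def e_def)
qed

text \<open>The index given by the western marking has its E-mark different from \<open>b\<close>,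
  so the cut condition yields \<open>w2 Y = c\<close> and the pair survives unchanged.\<close>

lemma marks_cut:
  assumes "mixed V R (V1 - {b})"
  shows "\<exists>Y. w Y \<in> V1 - {b} \<and> e Y \<in> V1 - {b}"
proof -
  have "mixed V1 R1 (V1 - {b})"
    using assms verts E.sources_subset E.sinks_subset unfolding mixed_def sources_eq sinks_eq by blast
  moreover have "edge_split V1 R1 a b (V1 - {b})"
    using verts W.adj_in b_adj by (auto simp: edge_split_def)
  ultimately obtain Y where Y: "w1 Y \<in> V1 - {b}" "e1 Y \<in> V1 - {b}"
    using markingD(3)[OF m1] by blast
  then have "w2 Y = c" using extremal by auto
  then show ?thesis using Y by (intro exI[of _ Y]) (auto simp: w_def e_def)
qed

lemma marks_W:
  assumes S: "edge_split V R x y S" and mix: "mixed V R S"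
    and xy: "(adj R1 x y \<and> x \<noteq> b \<and> y \<noteq> b) \<or> (x = a \<and> y = d)"
  shows "\<exists>Y. w Y \<in> S \<and> e Y \<in> S"
proof -
  interpret o: oriented_tree V R by (rule oriented_tree_cut)
  show ?thesis
  proof (cases "x = a \<and> y = d")
    case True
    then have "S = V1 - {b}" using o.split_unique S cut_split by blast
    then show ?thesis using marks_cut mix by blast
  next
    case False
    then have xy': "adj R1 x y" "x \<noteq> b" "y \<noteq> b" using xy by auto
    then obtain S1 where S1: "edge_split V1 R1 x y S1" using W.split_exists_adj by blast
    then have "S = lift S1" using o.split_unique S lift_split xy' by blast
    then show ?thesis using marks_lift[OF S1] xy' mix by blast
  qed
qed

end

lemma marking_cut:
  assumes m1: "marking V1 R1 w1 e1" and m2: "marking V2 R2 w2 e2"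
    and extremal: "\<And>Y. e1 Y = b \<or> w2 Y = c"
  shows "marking V R (\<lambda>Y. if w2 Y = c then w1 Y else w2 Y) (\<lambda>Y. if e1 Y = b then e2 Y else e1 Y)"
    (is "marking V R ?w ?e")
proof -
  interpret o: oriented_tree V R by (rule oriented_tree_cut)
  show ?thesis
    unfolding marking_def
  proof (intro conjI allI impI)
    fix Y
    show "?w Y \<in> sources V R" "?e Y \<in> sinks V R"
      using markingD(1,2)[OF m1] markingD(1,2)[OF m2] by (auto simp: sources_eq sinks_eq)
  next
    fix x y S assume S: "edge_split V R x y S" and mix: "mixed V R S"
    have "adj R x y" using S edge_splitD by fast
    then consider "(adj R1 x y \<and> x \<noteq> b \<and> y \<noteq> b) \<or> (x = a \<and> y = d)"
      | "(adj R2 x y \<and> x \<noteq> c \<and> y \<noteq> c) \<or> (x = d \<and> y = a)"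
      unfolding adj_iff by blast
    then show "\<exists>Y. ?w Y \<in> S \<and> ?e Y \<in> S"
    proof cases
      case 1
      then show ?thesis using marks_W[OF m1 m2 extremal _ _ S mix, of ?w ?e] by blast
    next
      case 2
      \<comment> \<open>The remaining bridges are the eastern ones and the new edge seen from
        \<open>d\<close>; in the dual cut they become western, with the roles of \<open>w\<close>
        and \<open>e\<close> exchanged.\<close>
      have ex: "w2 Y = c \<or> e1 Y = b" for Y using extremal by blast
      have "\<exists>Y. ?e Y \<in> S \<and> ?w Y \<in> S"
        using tree_cut.marks_W[OF dual_cut, of e2 w2 e1 w1 ?e ?w x y S, unfolded dual_V dual_R]
          m1 m2 ex S mix 2 by simp
      then show ?thesis by blast
    qed
  qed
qed

end

section \<open>Global K-graphs are marked trees\<close>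

lemma oriented_graph_iff:
  "oriented_graph D \<longleftrightarrow> pverts D \<noteq> {} \<and> finite (pverts D) \<and> parcs D \<subseteq> pverts D \<times> pverts D \<and>
     (\<forall>a b. (a, b) \<in> parcs D \<longrightarrow> (b, a) \<notin> parcs D)"
proof
  assume D: "oriented_graph D"
  then interpret pair_digraph D by (auto simp: oriented_graph_def is_digraph_def)
  show "pverts D \<noteq> {} \<and> finite (pverts D) \<and> parcs D \<subseteq> pverts D \<times> pverts D \<and>
     (\<forall>a b. (a, b) \<in> parcs D \<longrightarrow> (b, a) \<notin> parcs D)"
    using D in_arcsD1 in_arcsD2 by (auto simp: oriented_graph_def is_digraph_def)
next
  assume D: "pverts D \<noteq> {} \<and> finite (pverts D) \<and> parcs D \<subseteq> pverts D \<times> pverts D \<and>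
     (\<forall>a b. (a, b) \<in> parcs D \<longrightarrow> (b, a) \<notin> parcs D)"
  then have "finite (parcs D)" by (meson finite_SigmaI finite_subset)
  moreover have "fst x \<noteq> snd x" if "x \<in> parcs D" for x using D that by (metis prod.collapse)
  ultimately have "pair_digraph D" using D by unfold_locales auto
  then show "oriented_graph D" using D by (auto simp: oriented_graph_def is_digraph_def)
qed

lemma W_vertex_iff: "W_vertex D v \<longleftrightarrow> v \<in> sources (pverts D) (parcs D)"
  and E_vertex_iff: "E_vertex D v \<longleftrightarrow> v \<in> sinks (pverts D) (parcs D)"
  by (auto simp: W_vertex_def E_vertex_def sources_def sinks_def)

lemma inner_vertex_iff:
  "inner_vertex D v \<longleftrightarrow> v \<in> pverts D \<and> v \<notin> sources (pverts D) (parcs D) \<and> v \<notin> sinks (pverts D) (parcs D)"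
  by (auto simp: inner_vertex_def W_vertex_iff E_vertex_iff)

section \<open>Stars, the underlying graphs of basic K-graphs\<close>

locale star =
  fixes A :: "'a set" and b :: 'a and C :: "'a set"
  assumes finite: "finite A" "finite C" and ne: "A \<noteq> {}" "C \<noteq> {}"
    and disjoint: "A \<inter> C = {}" "b \<notin> A" "b \<notin> C"
begin

definition V where "V = A \<union> {b} \<union> C"
definition R where "R = A \<times> {b} \<union> {b} \<times> C"

lemma adj_iff: "adj R x y \<longleftrightarrow> (x = b \<and> y \<in> A \<union> C) \<or> (y = b \<and> x \<in> A \<union> C)"
  by (auto simp: adj_def R_def)

lemma sources_star: "sources V R = A" and sinks_star: "sinks V R = C"
  using ne disjoint by (auto simp: sources_def sinks_def V_def R_def)

lemma leaf_split: "x \<in> A \<union> C \<Longrightarrow> edge_split V R x b {x}"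
  using disjoint by (auto simp: edge_split_def adj_iff V_def)

lemma centre_split: "x \<in> A \<union> C \<Longrightarrow> edge_split V R b x (V - {x})"
  using disjoint by (auto simp: edge_split_def adj_iff V_def)

lemma star_tree: "WE_tree V R"
proof
  show "finite V" using finite by (simp add: V_def)
  show "R \<subseteq> V \<times> V" by (auto simp: R_def V_def)
  show "(y, x) \<notin> R" if "(x, y) \<in> R" for x y using that disjoint by (auto simp: R_def)
  show "cut_connected V R"
    unfolding cut_connected_def
  proof (intro allI impI)
    fix S assume S: "S \<subseteq> V" "S \<noteq> {}" and cl: "\<forall>u v. adj R u v \<longrightarrow> u \<in> S \<longrightarrow> v \<in> S"
    then obtain s where "s \<in> S" "s \<in> V" by blast
    then have "b \<in> S" using cl by (auto simp: adj_iff V_def)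
    then show "S = V" using cl S by (auto simp: adj_iff V_def)
  qed
  show "\<exists>S. edge_split V R x y S" if "(x, y) \<in> R" for x y
    using that leaf_split centre_split by (fastforce simp: R_def)
  show "x = y" if "v \<in> sources V R" "(v, x) \<in> R" "(v, y) \<in> R" for v x y
    using that disjoint unfolding sources_star by (auto simp: R_def)
  show "x = y" if "v \<in> sinks V R" "(x, v) \<in> R" "(y, v) \<in> R" for v x y
    using that disjoint unfolding sinks_star by (auto simp: R_def)
  show "\<exists>v\<in>V. v \<notin> sources V R \<and> v \<notin> sinks V R"
    unfolding sources_star sinks_star using disjoint by (auto simp: V_def)
qed

text \<open>The only sides are single leaves, which are never mixed, and complements of leaves. If
  the complement of a leaf \<open>y\<close> in \<open>A\<close> is mixed, then \<open>A\<close> has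
  another element, and a mark \<open>w Y\<close> other than \<open>y\<close> is needed; likewise for
  \<open>C\<close>. Two different marks are what serves all such \<open>y\<close>.\<close>

lemma marking_iff:
  "marking V R w e \<longleftrightarrow> (\<forall>Y. w Y \<in> A \<and> e Y \<in> C) \<and>
     (card A \<ge> 2 \<longrightarrow> w North \<noteq> w South) \<and> (card C \<ge> 2 \<longrightarrow> e North \<noteq> e South)"
    (is "_ \<longleftrightarrow> ?leaves \<and> ?distinct")
proof -
  interpret WE_tree V R by (rule star_tree)
  have two: "card X \<ge> 2 \<longleftrightarrow> (\<exists>x\<in>X. x \<noteq> y)" if "y \<in> X" "finite X" for X :: "'a set" and y
  proof -
    have "card X \<le> 1 \<longleftrightarrow> X = {y}" using that by (auto simp: card_le_Suc0_iff_eq)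
    then show ?thesis using that(1) by auto
  qed
  show ?thesis
  proof (intro iffI conjI)
    assume m: "marking V R w e"
    then show l: ?leaves by (simp add: marking_def sources_star sinks_star)
    have lne: "w Y \<noteq> e Z" for Y Z using l disjoint(1) by (metis IntI empty_iff)
    show "card A \<ge> 2 \<longrightarrow> w North \<noteq> w South"
    proof
      assume "card A \<ge> 2"
      then obtain x where "x \<in> A" "x \<noteq> w North" using two[of "w North" A] l finite by blast
      moreover then have "x \<in> V - {w North}" "e North \<in> V - {w North}"
        using l lne[of North North] by (auto simp: V_def)
      ultimately have "mixed V R (V - {w North})"
        using l unfolding mixed_def sources_star sinks_star by blast
      then obtain Y where "w Y \<noteq> w North" using markingD(3)[OF m centre_split] l by blast
      then show "w North \<noteq> w South" by (cases Y) auto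
    qed
    show "card C \<ge> 2 \<longrightarrow> e North \<noteq> e South"
    proof
      assume "card C \<ge> 2"
      then obtain x where "x \<in> C" "x \<noteq> e North" using two[of "e North" C] l finite by blast
      moreover then have "x \<in> V - {e North}" "w North \<in> V - {e North}"
        using l lne[of North North] by (auto simp: V_def)
      ultimately have "mixed V R (V - {e North})"
        using l unfolding mixed_def sources_star sinks_star by blast
      then obtain Y where "e Y \<noteq> e North" using markingD(3)[OF m centre_split] l by blast
      then show "e North \<noteq> e South" by (cases Y) auto
    qed
  next
    assume a: "?leaves \<and> ?distinct"
    show "marking V R w e"
      unfolding marking_def
    proof (intro conjI allI impI)
      show "w Y \<in> sources V R" "e Y \<in> sinks V R" for Y
        using a by (auto simp: sources_star sinks_star)
      fix x y S assume S: "edge_split V R x y S" and mix: "mixed V R S"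
      have "adj R x y" using edge_splitD(1)[OF S] .
      then consider "x = b" "y \<in> A \<union> C" | "y = b" "x \<in> A \<union> C" unfolding adj_iff by blast
      then show "\<exists>Y. w Y \<in> S \<and> e Y \<in> S"
      proof cases
        case 1
        then have S': "S = V - {y}" using split_unique[OF S] centre_split by blast
        have inV: "w Y \<in> V" "e Y \<in> V" for Y using a by (auto simp: V_def)
        obtain s t where st: "s \<in> A" "s \<noteq> y" "t \<in> C" "t \<noteq> y"
          using mix unfolding S' mixed_def sources_star sinks_star by blast
        show ?thesis
        proof (cases "y \<in> A")
          case True
          then have "w North \<noteq> w South" using two[of y A] st a finite by blast
          then obtain Y where "w Y \<noteq> y" by metis
          moreover have "e Y \<noteq> y" using a True disjoint by auto
          ultimately show ?thesis unfolding S' using inV by blast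
        next
          case False
          then have y: "y \<in> C" using 1 by blast
          then have "e North \<noteq> e South" using two[of y C] st a finite by blast
          then obtain Y where "e Y \<noteq> y" by metis
          moreover have "w Y \<noteq> y" using a False by auto
          ultimately show ?thesis unfolding S' using inV by blast
        qed
      next
        case 2
        then have "S = {x}" using split_unique[OF S] leaf_split by blast
        then show ?thesis using mix disjoint unfolding mixed_def sources_star sinks_star by auto
      qed
    qed
  qed
qed

end

text \<open>Markings speak of leaves only. The last conjunct recovers the distinguished edges from
  their leaves, so that comparing edges in the cut rule becomes comparing vertices.\<close>

definition marked_tree :: "'a ctree \<Rightarrow> bool" where
  "marked_tree G \<longleftrightarrow>
     WE_tree (pverts (root_graph G)) (parcs (root_graph G)) \<and>
     marking (pverts (root_graph G)) (parcs (root_graph G))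
       (\<lambda>Y. fst (root_edge G Y West)) (\<lambda>Y. snd (root_edge G Y East)) \<and>
     (\<forall>Y X. root_edge G Y X \<in> parcs (root_graph G))"

lemma basic_marked_tree:
  assumes "basic_K_graph B"
  shows "marked_tree (Single B)"
proof -
  obtain A b C where fin: "finite A" "finite C" and ge: "card A \<ge> 1" "card C \<ge> 1"
    and dj: "A \<inter> C = {}" "b \<notin> A" "b \<notin> C"
    and g: "graph_of B = \<lparr>pverts = A \<union> {b} \<union> C, parcs = A \<times> {b} \<union> {b} \<times> C\<rparr>"
    and W: "\<And>Y. W_edge (graph_of B) (dist_edge B Y West)"
    and E: "\<And>Y. E_edge (graph_of B) (dist_edge B Y East)"
    and distinct: "card A \<ge> 2 \<longrightarrow> dist_edge B North West \<noteq> dist_edge B South West"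
      "card C \<ge> 2 \<longrightarrow> dist_edge B North East \<noteq> dist_edge B South East"
    using assms unfolding basic_K_graph_def by (elim conjE exE) metis
  interpret star A b C using fin ge dj by unfold_locales auto
  have gr: "pverts (graph_of B) = V" "parcs (graph_of B) = R" using g by (auto simp: V_def R_def)
  have w: "dist_edge B Y West \<in> R" "fst (dist_edge B Y West) \<in> A" "snd (dist_edge B Y West) = b" for Y
    using W[of Y] disjoint unfolding W_edge_def W_vertex_iff gr sources_star by (auto simp: R_def)
  have e: "dist_edge B Y East \<in> R" "snd (dist_edge B Y East) \<in> C" "fst (dist_edge B Y East) = b" for Y
    using E[of Y] disjoint unfolding E_edge_def E_vertex_iff gr sinks_star by (auto simp: R_def)
  have "marking V R (\<lambda>Y. fst (dist_edge B Y West)) (\<lambda>Y. snd (dist_edge B Y East))"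
    unfolding marking_iff using w e distinct by (auto simp: prod_eq_iff)
  moreover have "dist_edge B Y X \<in> R" for Y X using w e by (cases X) auto
  ultimately show ?thesis
    using star_tree by (simp add: marked_tree_def root_graph_def root_edge_def gr)
qed

lemma construction_marked_tree: "construction G \<Longrightarrow> marked_tree G"
proof (induction rule: construction.induct)
  case (basic B)
  then show ?case by (rule basic_marked_tree)
next
  case (cut GW GE eW eE)
  let ?D1 = "root_graph GW" and ?D2 = "root_graph GE"
  obtain a b c d where eab: "eW = (a, b)" and ecd: "eE = (c, d)" by (cases eW, cases eE) auto
  note t = cut.IH[unfolded marked_tree_def]
  interpret tree_cut "pverts ?D1" "parcs ?D1" "pverts ?D2" "parcs ?D2" a b c d
  proof -
    interpret W: WE_tree "pverts ?D1" "parcs ?D1" using t by blast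
    interpret E: WE_tree "pverts ?D2" "parcs ?D2" using t by blast
    show "tree_cut (pverts ?D1) (parcs ?D1) (pverts ?D2) (parcs ?D2) a b c d"
      by unfold_locales
        (use cut.hyps eab ecd in \<open>auto simp: functional_E_edge_def functional_W_edge_def E_edge_def
           W_edge_def W_vertex_iff E_vertex_iff disjoint_graphs_def\<close>)
  qed
  let ?G = "cut_tree GW eW eE GE"
  have "root_graph ?G = cut_graph ?D1 eW eE ?D2" by (simp add: cut_tree_def root_graph_def)
  then have g: "pverts (root_graph ?G) = V" "parcs (root_graph ?G) = R"
    by (simp_all add: cut_graph_def V_def R_def eab ecd)
  have r1: "root_edge GW Y X \<in> parcs ?D1" and r2: "root_edge GE Y X \<in> parcs ?D2" for Y X
    using t by auto
  \<comment> \<open>The leaf \<open>c\<close> has no arc other than \<open>(c, d)\<close>, so a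
    distinguished edge beginning in \<open>c\<close> is that arc.\<close>
  have eqE: "eE = root_edge GE Y West \<longleftrightarrow> fst (root_edge GE Y West) = c" for Y
    using R2_c(2)[of "snd (root_edge GE Y West)"] r2[of Y West] unfolding ecd
    by (metis fst_conv prod.collapse)
  have eqW: "eW = root_edge GW Y East \<longleftrightarrow> snd (root_edge GW Y East) = b" for Y
    using R1_b(2)[of "fst (root_edge GW Y East)"] r1[of Y East] unfolding eab
    by (metis snd_conv prod.collapse)
  let ?w1 = "\<lambda>Y. fst (root_edge GW Y West)" and ?e1 = "\<lambda>Y. snd (root_edge GW Y East)"
  let ?w2 = "\<lambda>Y. fst (root_edge GE Y West)" and ?e2 = "\<lambda>Y. snd (root_edge GE Y East)"
  have m1: "marking (pverts ?D1) (parcs ?D1) ?w1 ?e1" and m2: "marking (pverts ?D2) (parcs ?D2) ?w2 ?e2"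
    using t by auto
  have ext: "?e1 Y = b \<or> ?w2 Y = c" for Y using cut.hyps(6)[of Y] eqE[of Y] eqW[of Y] by blast
  note m = marking_cut[OF m1 m2 ext]
  have re: "root_edge ?G = cut_edge GW eW eE GE"
    by (simp add: cut_tree_def root_edge_def)
  have w: "fst (root_edge ?G Y West) = (if ?w2 Y = c then ?w1 Y else ?w2 Y)"
    and e: "snd (root_edge ?G Y East) = (if ?e1 Y = b then ?e2 Y else ?e1 Y)" for Y
    using eqE[of Y] eqW[of Y] by (simp_all add: re)
  have in1: "(u, v) \<in> R" if "(u, v) \<in> parcs ?D1" "v \<noteq> b" for u v using that by (simp add: R_iff)
  have in2: "(u, v) \<in> R" if "(u, v) \<in> parcs ?D2" "u \<noteq> c" for u v using that by (simp add: R_iff)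
  \<comment> \<open>The distinguished edges must survive the cut: a W-edge of the western tree is
    not the removed arc, since an arc from a source cannot end in the sink \<open>b\<close>.\<close>
  have W: "root_edge ?G Y West \<in> R" for Y
  proof -
    have "snd (root_edge GW Y West) \<noteq> b"
      using W.source_edge_not_sink[of "?w1 Y" "snd (root_edge GW Y West)"] b_sink
        markingD(1)[OF m1] r1[of Y West] by auto
    then have "root_edge GW Y West \<in> R" using r1[of Y West] in1 by (metis prod.collapse)
    moreover have "root_edge GE Y West \<in> R" if "?w2 Y \<noteq> c"
      using r2[of Y West] in2 that by (metis prod.collapse)
    ultimately show ?thesis using eqE[of Y] by (simp add: re)
  qed
  have E: "root_edge ?G Y East \<in> R" for Y
  proof -
    have "fst (root_edge GE Y East) \<noteq> c"
      using E.source_edge_not_sink[of c "?e2 Y"] c_source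
        markingD(2)[OF m2, of Y] r2[of Y East] by (metis prod.collapse)
    then have "root_edge GE Y East \<in> R" using r2[of Y East] in2 by (metis prod.collapse)
    moreover have "root_edge GW Y East \<in> R" if "?e1 Y \<noteq> b"
      using r1[of Y East] in1 that by (metis prod.collapse)
    ultimately show ?thesis using eqW[of Y] by (simp add: re)
  qed
  have "root_edge ?G Y X \<in> R" for Y X using W E by (cases X) auto
  then show ?case using m WE_tree_cut unfolding marked_tree_def g w e by blast
qed

section \<open>Semipaths in trees\<close>

lemma rtrancl_distinct_list:
  assumes "(x, y) \<in> Q\<^sup>*"
  obtains xs where "xs \<noteq> []" "hd xs = x" "last xs = y" "distinct xs"
    "successively (\<lambda>u v. (u, v) \<in> Q) xs"
  using assms
proof (induction arbitrary: thesis rule: rtrancl_induct)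
  case base
  show ?case by (rule base[of "[x]"]) auto
next
  case (step y z)
  obtain xs where xs: "xs \<noteq> []" "hd xs = x" "last xs = y" "distinct xs"
    "successively (\<lambda>u v. (u, v) \<in> Q) xs" using step.IH by blast
  show ?case
  proof (cases "z \<in> set xs")
    case True
    then obtain p s where p: "xs = p @ z # s" by (meson split_list)
    have "hd (p @ [z]) = x" using xs(2) p by (cases p) auto
    then show ?thesis
      using xs p by (intro step.prems[of "p @ [z]"]) (auto simp: successively_append_iff)
  next
    case False
    then show ?thesis
      using xs step.hyps by (intro step.prems[of "xs @ [z]"]) (auto simp: successively_append_iff)
  qed
qed

lemma successively_crossing:
  assumes "successively P xs" "xs \<noteq> []" "hd xs \<in> S" "last xs \<notin> S"
  obtains u v where "P u v" "u \<in> S" "v \<notin> S" "u \<in> set xs" "v \<in> set xs"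
  using assms
proof (induction xs arbitrary: thesis rule: induct_list012)
  case (3 x y zs)
  show ?case
  proof (cases "y \<in> S")
    case True
    then show ?thesis using 3 by (metis list.sel(1) list.set_intros(2) last_ConsR list.distinct(1) successively.simps(3))
  next
    case False
    then show ?thesis using 3(3)[of x y] 3(4-) by auto
  qed
qed auto

lemma successively_last:
  assumes "successively P (x # y # xs)"
  shows "\<exists>u. P u (last (y # xs))"
  using assms by (induction xs arbitrary: x y) auto

lemma semiwalk_iff:
  "semiwalk D xs \<longleftrightarrow> xs \<noteq> [] \<and> set xs \<subseteq> pverts D \<and> successively (adj (parcs D)) xs"
  unfolding semiwalk_def adj_def[abs_def] by simp

context oriented_tree
begin

lemma distinct_walk_exists:
  assumes "x \<in> V" "y \<in> V"
  obtains xs where "xs \<noteq> []" "hd xs = x" "last xs = y" "distinct xs" "set xs \<subseteq> V"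
    "successively (adj R) xs"
proof -
  let ?Q = "{(u, v). adj R u v}"
  have "{v. (x, v) \<in> ?Q\<^sup>*} \<inter> V = V"
    using assms adj_in by (intro closed_eq[of _ x]) (auto intro: rtrancl_into_rtrancl)
  then have "(x, y) \<in> ?Q\<^sup>*" using assms by blast
  then obtain xs where xs: "xs \<noteq> []" "hd xs = x" "last xs = y" "distinct xs"
    "successively (\<lambda>u v. (u, v) \<in> ?Q) xs" by (rule rtrancl_distinct_list)
  then have s: "successively (adj R) xs" by simp
  have "set ys \<subseteq> V" if "successively (adj R) ys" "ys \<noteq> []" "hd ys \<in> V" for ys
    using that by (induction ys rule: induct_list012) (auto dest: adj_in)
  then show ?thesis using that[OF xs(1-4) _ s] xs s assms by blast
qed

text \<open>A distinct walk from \<open>b\<close> to a vertex of \<open>S\<close> has to start with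
  the bridge: otherwise its second vertex is outside \<open>S\<close>, and it could enter
  \<open>S\<close> only from \<open>b\<close>, visiting \<open>b\<close> twice.\<close>

lemma walk_through_split:
  assumes S: "edge_split V R a b S" and "c \<in> S"
  obtains ys where "distinct (b # a # ys)" "set (b # a # ys) \<subseteq> V" "successively (adj R) (b # a # ys)"
    "last (a # ys) = c"
proof -
  note s = edge_splitD[OF S]
  obtain xs where xs: "xs \<noteq> []" "hd xs = b" "last xs = c" "distinct xs" "set xs \<subseteq> V"
    "successively (adj R) xs"
    using distinct_walk_exists[of b c] adj_in[OF s(1)] s(2) \<open>c \<in> S\<close> by blast
  have "b \<noteq> c" using s \<open>c \<in> S\<close> by blast
  then obtain z ys where zs: "xs = b # z # ys"
    using xs by (metis hd_Cons_tl last_ConsL list.exhaust_sel)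
  have "z = a"
  proof (rule ccontr)
    assume za: "z \<noteq> a"
    have "adj R b z" using xs zs by simp
    then have "adj R z b" using adj_commute by metis
    then have z: "z \<notin> S" using edge_split_leave[OF S, of z b] s za by blast
    have "successively (adj R) (z # ys)" "last (z # ys) \<in> S" using xs zs \<open>c \<in> S\<close> by auto
    obtain u v where uv: "adj R u v" "u \<in> - S" "v \<notin> - S" "u \<in> set (z # ys)"
      by (rule successively_crossing[of "adj R" "z # ys" "- S"])
        (use z \<open>successively (adj R) (z # ys)\<close> \<open>last (z # ys) \<in> S\<close> in auto)
    then have "u = b" using edge_split_leave[OF S, of v u] adj_commute[of R u v] by blast
    then show False using uv xs zs by auto
  qed
  then show ?thesis using that[of ys] xs zs by auto
qed

text \<open>Some step of the walk follows an arc forwards, and the side which the first such step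
  enters contains a sink. Each backward step before it only shrinks the side, so this sink lies in
  \<open>S\<close>.\<close>

lemma forward_step_sink:
  assumes "edge_split V R a b S" "successively (adj R) (b # a # ys)" "distinct (b # a # ys)"
    and "\<not> successively (\<lambda>x y. (y, x) \<in> R) (b # a # ys)"
  shows "S \<inter> sinks V R \<noteq> {}"
  using assms
proof (induction ys arbitrary: a b S)
  case Nil
  then have "(b, a) \<in> R" by (auto simp: adj_def)
  then show ?case using head_side_has_sink Nil by blast
next
  case (Cons z ys)
  show ?case
  proof (cases "(b, a) \<in> R")
    case True
    then show ?thesis using head_side_has_sink Cons by blast
  next
    case False
    then have "(a, b) \<in> R" using Cons.prems by (auto simp: adj_def)
    then have n: "\<not> successively (\<lambda>x y. (y, x) \<in> R) (a # z # ys)" using Cons.prems by auto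
    have "adj R z a" using Cons.prems adj_commute[of R a z] by simp
    then obtain T where T: "edge_split V R z a T" using split_exists_adj by blast
    have "T \<inter> sinks V R \<noteq> {}" using Cons.IH[OF T _ _ n] Cons.prems by auto
    moreover have "T \<subset> S" using split_subset[OF Cons.prems(1) T] Cons.prems by auto
    ultimately show ?thesis by blast
  qed
qed

lemma backward_step_source:
  assumes "edge_split V R a b S" "successively (adj R) (b # a # ys)" "distinct (b # a # ys)"
    and "\<not> successively (\<lambda>x y. (x, y) \<in> R) (b # a # ys)"
  shows "S \<inter> sources V R \<noteq> {}"
proof -
  interpret d: oriented_tree V "R\<inverse>" by (rule dual)
  show ?thesis using d.forward_step_sink[of a b S ys] assms by simp
qed

end

text \<open>Only the bridge property needs work. The side of \<open>x\<close> consists of the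
  vertices reachable from \<open>x\<close> without using the edge to \<open>y\<close>; if
  \<open>y\<close> were reachable, the walk would close up to a semicycle.\<close>

lemma K_graph_tree:
  assumes D: "oriented_graph D" and wc: "weakly_connected D" and ac: "asemicyclic D"
    and fn: "WE_functional D" and inn: "inner_vertex D v"
  shows "WE_tree (pverts D) (parcs D)"
proof
  let ?V = "pverts D" and ?R = "parcs D"
  note o = D[unfolded oriented_graph_iff]
  show "finite ?V" "?R \<subseteq> ?V \<times> ?V" using o by auto
  show anti: "(y, x) \<notin> ?R" if "(x, y) \<in> ?R" for x y using o that by blast
  show "cut_connected ?V ?R"
    unfolding cut_connected_def
  proof (intro allI impI)
    fix S assume S: "S \<subseteq> ?V" "S \<noteq> {}" and cl: "\<forall>u v. adj ?R u v \<longrightarrow> u \<in> S \<longrightarrow> v \<in> S"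
    obtain u where u: "u \<in> S" using S by blast
    have "v \<in> S" if vV: "v \<in> ?V" for v
    proof (rule ccontr)
      assume v: "v \<notin> S"
      have "u \<in> ?V" using u S by blast
      then obtain xs where xs: "semipath D xs" "hd xs = u" "last xs = v"
        using wc[unfolded weakly_connected_def, rule_format, OF _ vV] by blast
      obtain a b where "adj ?R a b" "a \<in> S" "b \<notin> S"
        by (rule successively_crossing[of "adj ?R" xs S])
          (use xs u v in \<open>auto simp: semipath_def semiwalk_iff\<close>)
      then show False using cl by blast
    qed
    then show "S = ?V" using S by blast
  qed
  show "\<exists>S. edge_split ?V ?R x y S" if xy: "(x, y) \<in> ?R" for x y
  proof -
    define Q where "Q = {(u, v). adj ?R u v \<and> {u, v} \<noteq> {x, y}}"
    have xyV: "x \<in> ?V" "y \<in> ?V" "x \<noteq> y" using xy o by blast+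
    have "z \<in> ?V" if "(x, z) \<in> Q\<^sup>*" for z
      using that xyV(1) o by (induction rule: rtrancl_induct) (auto simp: Q_def adj_def)
    moreover have "(x, y) \<notin> Q\<^sup>*"
    proof
      assume "(x, y) \<in> Q\<^sup>*"
      then obtain xs where xs: "xs \<noteq> []" "hd xs = x" "last xs = y" "distinct xs"
        "successively (\<lambda>u v. (u, v) \<in> Q) xs" by (rule rtrancl_distinct_list)
      obtain z zs where zs: "xs = x # z # zs"
        using xs xyV by (metis hd_Cons_tl last_ConsL list.exhaust_sel)
      \<comment> \<open>The direct step from \<open>x\<close> to \<open>y\<close> is excluded from
        \<open>Q\<close>, so \<open>xs\<close> has at least three entries and the closed walk at
        least four, as a semicycle requires.\<close>
      have "zs \<noteq> []" using xs zs by (auto simp: Q_def)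
      have s: "successively (adj ?R) xs"
        using xs(5) by (rule successively_mono) (auto simp: Q_def)
      have "set ys \<subseteq> ?V" if "successively (adj ?R) ys" "ys \<noteq> []" "hd ys \<in> ?V" for ys
        using that o by (induction ys rule: induct_list012) (auto simp: adj_def)
      then have "set xs \<subseteq> ?V" using xs s xyV by blast
      then have "semiwalk D (xs @ [x])"
        using s xs xyV xy by (auto simp: semiwalk_iff successively_append_iff adj_def)
      then have "semicycle D (xs @ [x])"
        using zs \<open>zs \<noteq> []\<close> xs by (cases zs) (auto simp: semicycle_def)
      then show False using ac by (auto simp: asemicyclic_def)
    qed
    moreover have step: "(x, v) \<in> Q\<^sup>* \<or> u = x \<and> v = y" if "adj ?R u v" "(x, u) \<in> Q\<^sup>*" for u v
    proof (cases "(u, v) \<in> Q")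
      case True
      with that(2) have "(x, v) \<in> Q\<^sup>*" by (rule rtrancl_into_rtrancl)
      then show ?thesis ..
    next
      case False
      then have "{u, v} = {x, y}" using that by (auto simp: Q_def)
      then show ?thesis by (auto simp: doubleton_eq_iff)
    qed
    ultimately have "edge_split ?V ?R x y {z. (x, z) \<in> Q\<^sup>*}"
      using xy unfolding edge_split_def by (intro conjI) (auto simp: adj_def[of _ x y])
    then show ?thesis by blast
  qed
  show "x = y" if v: "v \<in> sources ?V ?R" "(v, x) \<in> ?R" "(v, y) \<in> ?R" for v x y
  proof -
    have "functional_W_edge D (v, x)"
      using fn v by (simp add: WE_functional_def W_edge_def W_vertex_iff)
    then show ?thesis using v(3) by (simp add: functional_W_edge_def)
  qed
  show "x = y" if v: "v \<in> sinks ?V ?R" "(x, v) \<in> ?R" "(y, v) \<in> ?R" for v x y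
  proof -
    have "functional_E_edge D (x, v)"
      using fn v by (simp add: WE_functional_def E_edge_def E_vertex_iff)
    then show ?thesis using v(3) by (simp add: functional_E_edge_def)
  qed
  show "\<exists>v\<in>?V. v \<notin> sources ?V ?R \<and> v \<notin> sinks ?V ?R" using inn unfolding inner_vertex_iff by blast
qed

lemma (in WE_tree) tree_split_system:
  "split_system V {S. \<exists>x y. edge_split V R x y S} (sources V R) (sinks V R)"
proof
  obtain v where v: "v \<in> V" "v \<notin> sources V R" "v \<notin> sinks V R" using inner by blast
  obtain u where u: "(u, v) \<in> R" using v by (auto simp: sources_def)
  obtain S where S: "edge_split V R u v S" using split_exists[OF u] by blast
  let ?F = "{S. \<exists>x y. edge_split V R x y S}"
  show "S \<inter> T = {} \<or> S \<subseteq> T \<or> T \<subseteq> S \<or> S \<union> T = V" if "S \<in> ?F" "T \<in> ?F" for S T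
    using split_compatible that by blast
  show "sources V R \<noteq> {}" "sinks V R \<noteq> {}"
    using tail_side_has_source[OF u S] head_side_has_sink[OF u split_compl[OF S]] by blast+
  show "S \<subseteq> V" if "S \<in> ?F" for S using that by (auto dest: edge_splitD(2))
  show "V - S \<in> ?F" if "S \<in> ?F" for S using that split_compl by (simp, metis)
qed (rule finite_V sources_subset sinks_subset)+

section \<open>Semipaths, transversal edges and bifurcations of a digraph that is a tree\<close>

locale digraph_tree = WE_tree "pverts D" "parcs D" for D :: "'a pair_pre_digraph"
begin

lemma semipath_iff:
  "semipath D xs \<longleftrightarrow> xs \<noteq> [] \<and> distinct xs \<and> set xs \<subseteq> pverts D \<and> successively (adj (parcs D)) xs"
  by (auto simp: semipath_def semiwalk_iff)

lemma proper_semipath_iff: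
  "proper_semipath D xs \<longleftrightarrow> semipath D xs \<and> \<not> successively (\<lambda>x y. (x, y) \<in> parcs D) xs \<and>
     \<not> successively (\<lambda>x y. (y, x) \<in> parcs D) xs"
proof -
  have "successively (adj (parcs D)) xs \<Longrightarrow> successively (adj (parcs D)) (rev xs)"
    unfolding successively_rev by (erule successively_mono) (metis adj_commute)
  then have "semipath D xs \<Longrightarrow> semipath D (rev xs)" by (simp add: semipath_iff)
  then show ?thesis by (auto simp: proper_semipath_def is_path_def successively_rev)
qed

lemma tree_weakly_connected: "weakly_connected D"
  unfolding weakly_connected_def semipath_iff by (meson distinct_walk_exists)

text \<open>Consider the side of \<open>x\<close> for the first edge of a semicycle. The next vertex
  after \<open>y\<close> is again outside, so the rest of the semicycle, which returns to
  \<open>x\<close>, can enter the side only from \<open>y\<close>, which would then be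
  repeated.\<close>

lemma tree_asemicyclic: "asemicyclic D"
  unfolding asemicyclic_def
proof
  assume "\<exists>xs. semicycle D xs"
  then obtain xs where sc: "semicycle D xs" ..
  then obtain x y z w ws where xs: "xs = x # y # z # w # ws"
    by (cases xs rule: list.exhaust) (auto simp: semicycle_def Suc_le_length_iff numeral_eq_Suc)
  have last: "last (w # ws) = x" and adj: "adj (parcs D) x y" "adj (parcs D) y z"
    and succ: "successively (adj (parcs D)) (z # w # ws)"
    and dist: "distinct (x # y # z # butlast (w # ws))"
    using sc unfolding xs semicycle_def semiwalk_iff by auto
  obtain S where S: "edge_split (pverts D) (parcs D) x y S" using split_exists_adj adj by blast
  note s = edge_splitD[OF S]
  have "z \<notin> S" using edge_split_leave[OF S, of z y] adj(2) s(4) dist adj_commute[of _ y z] by auto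
  obtain u v where uv: "adj (parcs D) u v" "u \<in> - S" "v \<notin> - S" "u \<in> set (z # w # ws)"
    by (rule successively_crossing[OF succ, of "- S"]) (use s(3) last \<open>z \<notin> S\<close> in auto)
  then have "u = y" using edge_split_leave[OF S, of v u] adj_commute[of _ u v] by blast
  moreover have eq: "w # ws = butlast (w # ws) @ [x]"
    using append_butlast_last_id[of "w # ws"] last by simp
  have "set (w # ws) \<subseteq> insert x (set (butlast (w # ws)))"
    by (subst eq) auto
  ultimately have "y \<in> insert z (insert x (set (butlast (w # ws))))" using uv(4) by auto
  then show False using dist by (simp del: butlast.simps)
qed

lemma tree_WE_functional: "WE_functional D"
  unfolding WE_functional_def functional_W_edge_def functional_E_edge_def W_edge_def E_edge_def
    W_vertex_iff E_vertex_iff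
  by (auto dest: source_functional sink_functional)

text \<open>The side of the tail always contains a source. A proper semipath starting with
  \<open>b\<close>, \<open>a\<close> does not run against all its arcs, and its forward step yields
  a sink there. The other side is dual.\<close>

lemma transversal_side_mixed:
  assumes T: "transversal_edge D (a, b)"
  shows "edge_split (pverts D) (parcs D) a b S \<Longrightarrow> mixed (pverts D) (parcs D) S"
    and "edge_split (pverts D) (parcs D) b a S \<Longrightarrow> mixed (pverts D) (parcs D) S"
proof -
  obtain xs ys where xs: "proper_semipath D (a # b # xs)" and ys: "proper_semipath D (b # a # ys)"
    and ab: "(a, b) \<in> parcs D" using T by (auto simp: transversal_edge_def)
  show "mixed (pverts D) (parcs D) S" if S: "edge_split (pverts D) (parcs D) a b S"
    using tail_side_has_source[OF ab S] forward_step_sink[OF S, of ys] ys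
    by (simp add: proper_semipath_iff semipath_iff mixed_def)
  show "mixed (pverts D) (parcs D) S" if S: "edge_split (pverts D) (parcs D) b a S"
    using head_side_has_sink[OF ab S] backward_step_source[OF S, of xs] xs
    by (simp add: proper_semipath_iff semipath_iff mixed_def)
qed

text \<open>A walk from \<open>b\<close> through \<open>a\<close> to a sink in \<open>S\<close>
  begins against the arc \<open>(a, b)\<close> and ends along an arc, since every arc at a sink
  enters it. So it is proper; a source in the other side gives the second semipath.\<close>

lemma transversal_if_mixed_sides:
  assumes ab: "(a, b) \<in> parcs D" and S: "edge_split (pverts D) (parcs D) a b S"
    and mix: "mixed (pverts D) (parcs D) S" "mixed (pverts D) (parcs D) (pverts D - S)"
  shows "transversal_edge D (a, b)"
proof -
  have ba: "(b, a) \<notin> parcs D" using antisymmetric ab .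
  obtain c where c: "c \<in> S" "c \<in> sinks (pverts D) (parcs D)" using mix by (auto simp: mixed_def)
  obtain ys where ys: "distinct (b # a # ys)" "set (b # a # ys) \<subseteq> pverts D"
    "successively (adj (parcs D)) (b # a # ys)" "last (a # ys) = c"
    using walk_through_split[OF S c(1)] .
  have "\<not> successively (\<lambda>x y. (y, x) \<in> parcs D) (b # a # ys)"
    using successively_last[of _ b a ys] ys(4) c(2) by (fastforce simp: sinks_def)
  then have 1: "proper_semipath D (b # a # ys)"
    using ys ba by (simp add: proper_semipath_iff semipath_iff)
  obtain c' where c': "c' \<in> pverts D - S" "c' \<in> sources (pverts D) (parcs D)"
    using mix by (auto simp: mixed_def)
  obtain xs where xs: "distinct (a # b # xs)" "set (a # b # xs) \<subseteq> pverts D"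
    "successively (adj (parcs D)) (a # b # xs)" "last (b # xs) = c'"
    using walk_through_split[OF split_compl[OF S] c'(1)] .
  have "\<not> successively (\<lambda>x y. (x, y) \<in> parcs D) (a # b # xs)"
    using successively_last[of _ a b xs] xs(4) c'(2) by (fastforce simp: sources_def)
  then have 2: "proper_semipath D (a # b # xs)"
    using xs ba by (simp add: proper_semipath_iff semipath_iff)
  show ?thesis using 1 2 ab by (auto simp: transversal_edge_def)
qed

lemma marked_no_transversal_bifurcation:
  assumes m: "marking (pverts D) (parcs D) w e"
  shows "\<not> transversal_bifurcation D e1 e2 e3"
proof
  let ?V = "pverts D" and ?R = "parcs D"
  assume t: "transversal_bifurcation D e1 e2 e3"
  then obtain v where v: "v = fst f \<or> v = snd f" if "f \<in> {e1, e2, e3}" for f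
    unfolding transversal_bifurcation_def bifurcation_def by blast
  have d: "e1 \<noteq> e2" "e1 \<noteq> e3" "e2 \<noteq> e3" and E: "f \<in> {e1, e2, e3} \<Longrightarrow> f \<in> ?R" for f
    using t by (auto simp: transversal_bifurcation_def bifurcation_def)
  define other where "other f = (if fst f = v then snd f else fst f)" for f
  have edge: "f = (other f, v) \<or> f = (v, other f)" if "f \<in> {e1, e2, e3}" for f
    using v[OF that] by (auto simp: other_def prod_eq_iff)
  \<comment> \<open>Two different edges at \<open>v\<close> with the same other end would be
    opposite arcs.\<close>
  have inj: "other f \<noteq> other g" if "f \<in> {e1, e2, e3}" "g \<in> {e1, e2, e3}" "f \<noteq> g" for f g
    using edge[OF that(1)] edge[OF that(2)] E[OF that(1)] E[OF that(2)] antisymmetric that(3)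
    by metis
  have branch: "\<exists>Z Y. edge_split ?V ?R (other f) v Z \<and> w Y \<in> Z" if f: "f \<in> {e1, e2, e3}" for f
  proof -
    have "adj ?R (other f) v" using edge[OF f] E[OF f] by (metis adj_def)
    then obtain Z where Z: "edge_split ?V ?R (other f) v Z" using split_exists_adj by blast
    have "transversal_edge D f" using t f by (auto simp: transversal_bifurcation_def)
    then have "mixed ?V ?R Z" using edge[OF f] transversal_side_mixed Z by metis
    then show ?thesis using markingD(3)[OF m Z] Z by blast
  qed
  obtain Z1 Y1 where 1: "edge_split ?V ?R (other e1) v Z1" "w Y1 \<in> Z1" using branch[of e1] by auto
  obtain Z2 Y2 where 2: "edge_split ?V ?R (other e2) v Z2" "w Y2 \<in> Z2" using branch[of e2] by auto
  obtain Z3 Y3 where 3: "edge_split ?V ?R (other e3) v Z3" "w Y3 \<in> Z3" using branch[of e3] by auto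
  have "Z1 \<inter> Z2 = {}" "Z1 \<inter> Z3 = {}" "Z2 \<inter> Z3 = {}"
    using branches_disjoint[OF 1(1) 2(1)] branches_disjoint[OF 1(1) 3(1)]
      branches_disjoint[OF 2(1) 3(1)] inj d by auto
  then have "Y1 \<noteq> Y2" "Y1 \<noteq> Y3" "Y2 \<noteq> Y3" using 1 2 3 by auto
  then show False by (metis ns.exhaust)
qed

text \<open>The three sides can be replaced by three mixed branches at one vertex \<open>y\<close>.
  The complement of each branch contains another of them and is mixed too, so the three edges at
  \<open>y\<close> are transversal.\<close>

lemma no_three_disjoint_mixed:
  assumes nt: "\<nexists>e1 e2 e3. transversal_bifurcation D e1 e2 e3"
    and S: "edge_split (pverts D) (parcs D) a1 b1 S1" "edge_split (pverts D) (parcs D) a2 b2 S2"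
      "edge_split (pverts D) (parcs D) a3 b3 S3"
    and mix: "mixed (pverts D) (parcs D) S1" "mixed (pverts D) (parcs D) S2" "mixed (pverts D) (parcs D) S3"
    and dj: "S1 \<inter> S2 = {}" "S1 \<inter> S3 = {}"
  shows "S2 \<inter> S3 \<noteq> {}"
proof
  let ?V = "pverts D" and ?R = "parcs D"
  assume dj3: "S2 \<inter> S3 = {}"
  obtain y x1 x2 x3 T1 T2 T3 where
    T: "edge_split ?V ?R x1 y T1" "edge_split ?V ?R x2 y T2" "edge_split ?V ?R x3 y T3"
    and m: "mixed ?V ?R T1" "mixed ?V ?R T2" "mixed ?V ?R T3"
    and ne: "x1 \<noteq> x2" "x1 \<noteq> x3" "x2 \<noteq> x3"
    by (rule three_mixed_branches[OF S mix dj dj3])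
  define f where "f x = (if (x, y) \<in> ?R then (x, y) else (y, x))" for x
  have tr: "transversal_edge D (f x)"
    if "edge_split ?V ?R x y T" "mixed ?V ?R T" "edge_split ?V ?R z y U" "mixed ?V ?R U" "x \<noteq> z"
    for x z T U
  proof -
    have "U \<subseteq> ?V - T" using branches_disjoint[OF that(1,3,5)] edge_splitD(2)[OF that(3)] by blast
    then have mc: "mixed ?V ?R (?V - T)" using mixed_mono that by blast
    have TV: "?V - (?V - T) = T" using edge_splitD(2)[OF that(1)] by blast
    show ?thesis
    proof (cases "(x, y) \<in> ?R")
      case True
      then show ?thesis using transversal_if_mixed_sides that mc by (simp add: f_def)
    next
      case False
      then have "(y, x) \<in> ?R" using edge_splitD(1)[OF that(1)] by (auto simp: adj_def)
      then show ?thesis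
        using transversal_if_mixed_sides[OF _ split_compl[OF that(1)]] False that mc TV
        by (simp add: f_def)
    qed
  qed
  have "transversal_edge D (f x1)" "transversal_edge D (f x2)" "transversal_edge D (f x3)"
    using tr[OF T(1) m(1) T(2) m(2)] tr[OF T(2) m(2) T(1) m(1)] tr[OF T(3) m(3) T(1) m(1)] ne by auto
  moreover have "f x1 \<noteq> f x2" "f x1 \<noteq> f x3" "f x2 \<noteq> f x3" using ne by (auto simp: f_def)
  moreover have "y = fst (f x) \<or> y = snd (f x)" for x by (simp add: f_def)
  ultimately have "transversal_bifurcation D (f x1) (f x2) (f x3)"
    unfolding transversal_bifurcation_def bifurcation_def by (auto simp: transversal_edge_def)
  then show False using nt by blast
qed

lemma marking_exists:
  assumes nt: "\<nexists>e1 e2 e3. transversal_bifurcation D e1 e2 e3"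
  obtains w e where "marking (pverts D) (parcs D) w e"
proof -
  let ?V = "pverts D" and ?R = "parcs D"
  let ?F = "{S. \<exists>x y. edge_split ?V ?R x y S}"
  interpret s: split_system ?V ?F "sources ?V ?R" "sinks ?V ?R" by (rule tree_split_system)
  have bi: "s.bi S \<longleftrightarrow> (\<exists>x y. edge_split ?V ?R x y S) \<and> mixed ?V ?R S" for S
    by (simp add: s.bi_def mixed_def)
  have no3: "T \<inter> U \<noteq> {}" if bis: "s.bi S" "s.bi T" "s.bi U" and "S \<inter> T = {}" "S \<inter> U = {}" for S T U
  proof -
    obtain a1 b1 a2 b2 a3 b3 where "edge_split ?V ?R a1 b1 S" "edge_split ?V ?R a2 b2 T"
      "edge_split ?V ?R a3 b3 U" using bis unfolding bi by metis
    then show ?thesis using no_three_disjoint_mixed[OF nt] that unfolding bi by metis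
  qed
  obtain w e :: "ns \<Rightarrow> 'a" where we: "\<And>Y. w Y \<in> sources ?V ?R" "\<And>Y. e Y \<in> sinks ?V ?R"
    "\<And>S. s.bi S \<Longrightarrow> \<exists>Y. w Y \<in> S \<and> e Y \<in> S"
  proof (rule s.two_pairs)
    show "T \<inter> U \<noteq> {}" if "s.bi S" "s.bi T" "s.bi U" "S \<inter> T = {}" "S \<inter> U = {}" for S T U
      using that by (rule no3)
  qed blast
  have "marking ?V ?R w e"
    unfolding marking_def
  proof (intro conjI allI impI we(1,2))
    show "\<exists>Y. w Y \<in> S \<and> e Y \<in> S" if "edge_split ?V ?R x y S" "mixed ?V ?R S" for x y S
      by (rule we(3)) (use that in \<open>auto simp: bi\<close>)
  qed
  then show ?thesis using that by blast
qed

end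

section \<open>Marked trees are global K-graphs\<close>

locale tree_uncut = WE_tree +
  fixes a d b c :: 'a and A :: "'a set"
  assumes ad: "(a, d) \<in> R" and a_inner: "a \<notin> sources V R" and d_inner: "d \<notin> sinks V R"
    and A: "edge_split V R a d A" and fresh: "b \<notin> V" "c \<notin> V" "b \<noteq> c"
begin

definition V1 where "V1 = insert b A"
definition R1 where "R1 = {(u, v) \<in> R. u \<in> A \<and> v \<in> A} \<union> {(a, b)}"
definition V2 where "V2 = insert c (V - A)"
definition R2 where "R2 = {(u, v) \<in> R. u \<in> V - A \<and> v \<in> V - A} \<union> {(c, d)}"

lemma verts: "a \<in> A" "d \<notin> A" "A \<subseteq> V" "a \<in> V" "d \<in> V" "b \<notin> A" "c \<notin> A" "a \<noteq> b" "d \<noteq> c"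
  using edge_splitD[OF A] edges_subset ad fresh by auto

lemma dual_uncut: "tree_uncut V (R\<inverse>) d a c b (V - A)"
  using dual_WE ad a_inner d_inner split_compl[OF A] fresh
  by (auto simp: tree_uncut_def tree_uncut_axioms_def)

lemma dual_V1: "tree_uncut.V1 c (V - A) = V2"
  unfolding tree_uncut.V1_def[OF dual_uncut] V2_def by simp

lemma dual_R1: "tree_uncut.R1 (R\<inverse>) d c (V - A) = R2\<inverse>"
  unfolding tree_uncut.R1_def[OF dual_uncut] R2_def by auto

lemma crossing: "adj R u v \<Longrightarrow> u \<in> A \<Longrightarrow> v \<notin> A \<Longrightarrow> u = a \<and> v = d"
  by (rule edge_split_leave[OF A])

lemma adj_R1: "adj R1 u v \<longleftrightarrow> (adj R u v \<and> u \<in> A \<and> v \<in> A) \<or> (u = a \<and> v = b) \<or> (u = b \<and> v = a)"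
  by (auto simp: adj_def R1_def)

lemma sources_V1: "sources V1 R1 = sources V R \<inter> A"
proof (intro set_eqI iffI)
  fix v assume "v \<in> sources V1 R1"
  then have v: "v \<in> V1" "\<And>u. (u, v) \<notin> R1" by (auto simp: sources_def)
  then have vA: "v \<in> A" by (auto simp: V1_def R1_def)
  have "(u, v) \<notin> R" for u
  proof
    assume uv: "(u, v) \<in> R"
    then have "u \<notin> A" using v(2)[of u] vA by (auto simp: R1_def)
    then have "v = a \<and> u = d" using crossing[of v u] uv vA by (auto simp: adj_def)
    then show False using uv ad antisymmetric by blast
  qed
  then show "v \<in> sources V R \<inter> A" using vA verts by (auto simp: sources_def)
next
  fix v assume "v \<in> sources V R \<inter> A"
  then show "v \<in> sources V1 R1" using verts by (auto simp: sources_def V1_def R1_def)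
qed

lemma sinks_V1: "sinks V1 R1 = insert b (sinks V R \<inter> A)"
proof (intro set_eqI iffI)
  fix v assume "v \<in> sinks V1 R1"
  then have v: "v \<in> V1" "\<And>u. (v, u) \<notin> R1" by (auto simp: sinks_def)
  show "v \<in> insert b (sinks V R \<inter> A)"
  proof (cases "v = b")
    case False
    then have vA: "v \<in> A" using v by (auto simp: V1_def)
    have "v \<noteq> a" using v(2)[of b] by (auto simp: R1_def)
    then have "(v, u) \<notin> R" for u
      using crossing[of v u] v(2)[of u] vA by (auto simp: adj_def R1_def)
    then show ?thesis using vA verts by (auto simp: sinks_def)
  qed simp
next
  fix v assume v: "v \<in> insert b (sinks V R \<inter> A)"
  moreover have "v \<noteq> a" using v verts ad by (auto simp: sinks_def)
  ultimately show "v \<in> sinks V1 R1" using verts by (auto simp: sinks_def V1_def R1_def)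
qed

lemma bridge_split_V1: "edge_split V1 R1 a b A"
  using verts by (auto simp: edge_split_def adj_R1 V1_def)

lemma split_V1:
  assumes S: "edge_split V R x y S" and xy: "x \<in> A" "y \<in> A"
  shows "edge_split V1 R1 x y (S \<inter> A \<union> (if a \<in> S then {b} else {}))"
proof -
  note s = edge_splitD[OF S]
  show ?thesis
    unfolding edge_split_def
  proof (intro conjI allI impI)
    show "adj R1 x y" using s xy by (simp add: adj_R1)
    show "y \<notin> S \<inter> A \<union> (if a \<in> S then {b} else {})" using s xy verts by auto
    fix u v assume "adj R1 u v" "u \<in> S \<inter> A \<union> (if a \<in> S then {b} else {})"
      "v \<notin> S \<inter> A \<union> (if a \<in> S then {b} else {})"
    then have "adj R u v \<and> u \<in> S \<and> v \<notin> S"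
      using verts unfolding adj_R1 by (auto split: if_splits)
    then show "u = x" "v = y" using edge_split_leave[OF S] by blast+
  qed (use s xy in \<open>auto simp: V1_def\<close>)
qed

lemma WE_tree_V1: "WE_tree V1 R1"
proof
  show "finite V1" using finite_V verts finite_subset by (auto simp: V1_def)
  show "R1 \<subseteq> V1 \<times> V1" using verts by (auto simp: R1_def V1_def)
  show "(y, x) \<notin> R1" if "(x, y) \<in> R1" for x y
    using that antisymmetric verts by (auto simp: R1_def)
  show "cut_connected V1 R1"
    unfolding cut_connected_def
  proof (intro allI impI)
    fix S assume S: "S \<subseteq> V1" "S \<noteq> {}" and cl: "\<forall>u v. adj R1 u v \<longrightarrow> u \<in> S \<longrightarrow> v \<in> S"
    have ab: "a \<in> S \<longleftrightarrow> b \<in> S" using cl adj_R1 by blast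
    \<comment> \<open>The leaf \<open>b\<close> represents the whole of \<open>V - A\<close>:
      replacing it by that set turns a closed set of the half into a closed set of the tree.\<close>
    define S' where "S' = S \<inter> A \<union> (if a \<in> S then V - A else {})"
    obtain s where s: "s \<in> S'" using S ab verts by (auto simp: S'_def V1_def)
    have "S' = V"
    proof (rule closed_eq[OF _ s])
      show "S' \<subseteq> V" using verts by (auto simp: S'_def)
      fix u v assume uv: "adj R u v" "u \<in> S'"
      have vu: "adj R v u" using uv adj_commute by metis
      consider "u \<in> A" "v \<in> A" | "u \<in> A" "v \<notin> A" | "u \<notin> A" "v \<in> A" | "u \<notin> A" "v \<notin> A" by blast
      then show "v \<in> S'"
      proof cases
        case 1
        then have "u \<in> S" "adj R1 u v" using uv by (auto simp: S'_def adj_R1 split: if_splits)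
        then show ?thesis using 1 cl by (auto simp: S'_def)
      next
        case 2
        then show ?thesis using uv crossing[OF uv(1)] verts by (auto simp: S'_def split: if_splits)
      next
        case 3
        then show ?thesis using uv crossing[OF vu] verts by (auto simp: S'_def split: if_splits)
      next
        case 4
        then show ?thesis using uv adj_in[OF uv(1)] by (auto simp: S'_def split: if_splits)
      qed
    qed
    then have "A \<subseteq> S" using verts by (auto simp: S'_def split: if_splits)
    then show "S = V1" using S ab verts by (auto simp: V1_def)
  qed
  show "\<exists>S. edge_split V1 R1 x y S" if xy: "(x, y) \<in> R1" for x y
  proof (cases "(x, y) = (a, b)")
    case True
    then show ?thesis using bridge_split_V1 by blast
  next
    case False
    then have "(x, y) \<in> R" "x \<in> A" "y \<in> A" using xy by (auto simp: R1_def)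
    then show ?thesis using split_exists split_V1 by meson
  qed
  show "x = y" if v: "v \<in> sources V1 R1" "(v, x) \<in> R1" "(v, y) \<in> R1" for v x y
  proof -
    have "v \<in> sources V R" "v \<noteq> a" using v(1) a_inner unfolding sources_V1 by auto
    then show ?thesis using source_functional v(2,3) by (auto simp: R1_def)
  qed
  show "x = y" if v: "v \<in> sinks V1 R1" "(x, v) \<in> R1" "(y, v) \<in> R1" for v x y
  proof (cases "v = b")
    case True
    then show ?thesis using v(2,3) verts by (auto simp: R1_def)
  next
    case False
    then have "v \<in> sinks V R" "(x, v) \<in> R" "(y, v) \<in> R" using v unfolding sinks_V1 by (auto simp: R1_def)
    then show ?thesis using sink_functional by blast
  qed
  have "a \<in> V1" "a \<notin> sources V1 R1" "a \<notin> sinks V1 R1"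
    using verts a_inner ad unfolding sources_V1 sinks_V1 by (auto simp: V1_def sinks_def)
  then show "\<exists>v\<in>V1. v \<notin> sources V1 R1 \<and> v \<notin> sinks V1 R1" by blast
qed

lemma WE_tree_V2: "WE_tree V2 R2"
proof -
  have "WE_tree V2 (R2\<inverse>)"
    using tree_uncut.WE_tree_V1[OF dual_uncut] unfolding dual_V1 dual_R1 .
  then show ?thesis using WE_tree.dual_WE[of V2 "R2\<inverse>"] by simp
qed

text \<open>The half trades \<open>V - A\<close> for the single vertex \<open>b\<close>, and
  \<open>V - A\<close> has at least two elements: \<open>d\<close> and, since \<open>d\<close> is no
  sink, a successor of \<open>d\<close>.\<close>

lemma card_V1: "card V1 < card V"
proof -
  obtain z where z: "(d, z) \<in> R" using d_inner verts by (auto simp: sinks_def)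
  have "z \<in> V" "z \<noteq> d" using z edges_subset antisymmetric by auto
  moreover have "z \<notin> A"
  proof
    assume "z \<in> A"
    then have "z = a" using crossing[of z d] z verts by (auto simp: adj_def)
    then show False using z ad antisymmetric by blast
  qed
  ultimately have "insert z A \<subset> V" using verts by auto
  then have "card (insert z A) < card V" using finite_V by (simp add: psubset_card_mono)
  moreover have "finite A" using finite_V verts finite_subset by blast
  ultimately show ?thesis using verts \<open>z \<notin> A\<close> by (simp add: V1_def)
qed

lemma card_V2: "card V2 < card V"
  using tree_uncut.card_V1[OF dual_uncut] unfolding dual_V1 .

lemma uncut_tree_cut: "tree_cut V1 R1 V2 R2 a b c d"
proof -
  interpret T1: WE_tree V1 R1 by (rule WE_tree_V1)
  interpret T2: WE_tree V2 R2 by (rule WE_tree_V2)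
  show ?thesis
  proof
    show "c \<in> sources V2 R2" using fresh edges_subset verts by (auto simp: sources_def V2_def R2_def)
    show "b \<in> sinks V1 R1" by (simp add: sinks_V1)
    show "V1 \<inter> V2 = {}" using fresh verts by (auto simp: V1_def V2_def)
  qed (simp_all add: R1_def R2_def)
qed

lemma cut_V: "tree_cut.V V1 V2 b c = V"
  unfolding tree_cut.V_def[OF uncut_tree_cut] using verts fresh by (auto simp: V1_def V2_def)

lemma cut_R: "tree_cut.R R1 R2 a b c d = R"
proof -
  interpret cut: tree_cut V1 R1 V2 R2 a b c d by (rule uncut_tree_cut)
  have "(u, v) \<in> cut.R \<longleftrightarrow> (u, v) \<in> R" for u v
  proof
    assume "(u, v) \<in> cut.R"
    then show "(u, v) \<in> R" unfolding cut.R_def using ad by (auto simp: R1_def R2_def)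
  next
    assume uv: "(u, v) \<in> R"
    then have V: "u \<in> V" "v \<in> V" using edges_subset by auto
    have ne: "u \<noteq> c" "v \<noteq> b" using V fresh by auto
    consider "u \<in> A" "v \<in> A" | "u \<in> A" "v \<notin> A" | "u \<notin> A" "v \<in> A" | "u \<notin> A" "v \<notin> A" by blast
    then show "(u, v) \<in> cut.R"
    proof cases
      case 2
      then show ?thesis using crossing[of u v] uv unfolding cut.R_def by (auto simp: adj_def)
    next
      case 3
      then have "v = a \<and> u = d" using crossing[of v u] uv by (auto simp: adj_def)
      then show ?thesis using uv ad antisymmetric by blast
    qed (use uv V ne in \<open>unfold cut.R_def, auto simp: R1_def R2_def\<close>)
  qed
  then show ?thesis by auto
qed

context
  fixes w e e1 :: "ns \<Rightarrow> 'a"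
  assumes m: "marking V R w e" and e1_def: "\<And>Y. e1 Y = (if e Y \<in> A then e Y else b)"
begin

text \<open>This is the cut condition in disguise. A violating \<open>Y\<close> would make both
  \<open>A\<close> and \<open>V - A\<close> mixed; the indices serving these two sides differ from
  each other and from \<open>Y\<close>, but there are only two indices.\<close>

lemma mark_east: "w Y \<notin> A \<Longrightarrow> e Y \<notin> A"
proof
  assume Y: "w Y \<notin> A" "e Y \<in> A"
  have "mixed V R A"
    using tail_side_has_source[OF ad A] Y markingD(2)[OF m] unfolding mixed_def by blast
  then obtain Y1 where Y1: "w Y1 \<in> A" using markingD(3)[OF m A] by blast
  have "w Y \<in> (V - A) \<inter> sources V R" using Y markingD(1)[OF m, of Y] sources_subset by blast
  then have "mixed V R (V - A)"
    using head_side_has_sink[OF ad split_compl[OF A]] unfolding mixed_def by blast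
  then obtain Y2 where "w Y2 \<in> V - A" "e Y2 \<in> V - A"
    using markingD(3)[OF m split_compl[OF A]] by blast
  then have "Y \<noteq> Y1" "Y \<noteq> Y2" "Y1 \<noteq> Y2" using Y Y1 by auto
  then show False by (metis ns.exhaust)
qed

text \<open>A mixed side of the half, other than that of its bridge at \<open>b\<close>, lifts to a
  mixed side of \<open>V\<close>: if \<open>b\<close> is its only sink, the lift contains
  \<open>V - A\<close>, which has a sink of its own. An index for the lift then works for
  \<open>S\<close> with lost vertices represented by \<open>b\<close>. As \<open>b\<close> is not a
  source, a lost \<open>w Y\<close> leaves only the information that \<open>b\<close> is in
  \<open>S\<close>.\<close>

lemma mixed_side_V1:
  assumes S: "edge_split V1 R1 x y S" and mix: "mixed V1 R1 S"
  obtains Y where "w Y \<in> A \<Longrightarrow> w Y \<in> S" "w Y \<notin> A \<Longrightarrow> b \<in> S" "e1 Y \<in> S"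
proof -
  note s = edge_splitD[OF S]
  interpret cut: tree_cut V1 R1 V2 R2 a b c d by (rule uncut_tree_cut)
  have lift_iff: "v \<in> cut.lift S \<longleftrightarrow> (v \<in> S \<and> v \<noteq> b) \<or> (b \<in> S \<and> v \<in> V - A)" for v
    unfolding cut.lift_def using fresh by (auto simp: V2_def)
  have w: "w Y \<in> V" and e: "e Y \<in> V" for Y
    using markingD(1,2)[OF m] sources_subset sinks_subset by blast+
  have "\<exists>Y. (w Y \<in> A \<longrightarrow> w Y \<in> S) \<and> (w Y \<notin> A \<longrightarrow> b \<in> S) \<and> e1 Y \<in> S"
  proof -
    consider "x \<noteq> b" "y \<noteq> b" | "x = b" "y = a" | "x = a" "y = b"
      using s(1) verts(6) unfolding adj_R1 by blast
    then show ?thesis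
    proof cases
      case 1
      then have S': "edge_split V R x y (cut.lift S)" using cut.lift_split[OF S] by (simp add: cut_V cut_R)
      have "mixed V R (cut.lift S)"
      proof -
        have sub: "S - {b} \<subseteq> cut.lift S" by (auto simp: lift_iff)
        have "cut.lift S \<inter> sources V R \<noteq> {}"
          using mix sub verts unfolding mixed_def sources_V1 by blast
        moreover have "cut.lift S \<inter> sinks V R \<noteq> {}"
        proof (cases "b \<in> S")
          case True
          then have "V - A \<subseteq> cut.lift S" using fresh by (auto simp: lift_iff)
          then show ?thesis using head_side_has_sink[OF ad split_compl[OF A]] by blast
        next
          case False
          then show ?thesis using mix sub unfolding mixed_def sinks_V1 by blast
        qed
        ultimately show ?thesis by (simp add: mixed_def)
      qed
      then obtain Y where Y: "w Y \<in> cut.lift S" "e Y \<in> cut.lift S" using markingD(3)[OF m S'] by blast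
      have "v \<in> S \<or> (v \<notin> A \<and> b \<in> S)" if "v \<in> cut.lift S" for v
        using that verts by (auto simp: lift_iff split: if_splits)
      then have "w Y \<in> S \<or> (w Y \<notin> A \<and> b \<in> S)" "e Y \<in> S \<or> (e Y \<notin> A \<and> b \<in> S)" using Y by blast+
      moreover have "v \<in> A" if "v \<in> S" "v \<in> V" for v using that s(2) fresh by (auto simp: V1_def)
      ultimately show ?thesis using w e by (intro exI[of _ Y]) (auto simp: e1_def)
    next
      case 2
      then have "S = V1 - A" using cut.W.split_unique[OF S] cut.W.split_compl[OF bridge_split_V1] by blast
      then show ?thesis using mix unfolding mixed_def sources_V1 by blast
    next
      case 3
      then have SA: "S = A" using cut.W.split_unique[OF S] bridge_split_V1 by blast
      then have "mixed V R A" using mix verts unfolding mixed_def sources_V1 sinks_V1 by blast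
      then obtain Y where "w Y \<in> A" "e Y \<in> A" using markingD(3)[OF m A] by blast
      then show ?thesis unfolding SA e1_def by (intro exI[of _ Y]) auto
    qed
  qed
  then show ?thesis using that by blast
qed

text \<open>If some \<open>w Y0\<close> is lost, its E-mark is \<open>b\<close> by
  \<open>mark_east\<close>. Mixed sides without \<open>b\<close> must then be served by the other
  index, which is the hypothesis of \<open>pair_extension\<close>; that lemma supplies a new partner
  for \<open>b\<close>.\<close>

lemma marking_V1: "\<exists>w1. marking V1 R1 w1 e1 \<and> (\<forall>Y. w Y \<in> A \<longrightarrow> w1 Y = w Y)"
proof -
  interpret W: WE_tree V1 R1 by (rule WE_tree_V1)
  interpret s: split_system V1 "{S. \<exists>x y. edge_split V1 R1 x y S}" "sources V1 R1" "sinks V1 R1"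
    by (rule W.tree_split_system)
  have bi: "s.bi S \<longleftrightarrow> (\<exists>x y. edge_split V1 R1 x y S) \<and> mixed V1 R1 S" for S
    by (simp add: s.bi_def mixed_def)
  have pair: "\<exists>Y. (w Y \<in> A \<longrightarrow> w Y \<in> S) \<and> (w Y \<notin> A \<longrightarrow> b \<in> S) \<and> e1 Y \<in> S" if "s.bi S" for S
    using that mixed_side_V1 unfolding bi by metis
  have e1: "e1 Y \<in> sinks V1 R1" for Y
    using markingD(2)[OF m] by (auto simp: e1_def sinks_V1)
  have src: "w Y \<in> sources V1 R1" if "w Y \<in> A" for Y
    using markingD(1)[OF m] that by (simp add: sources_V1)
  show ?thesis
  proof (cases "\<forall>Y. w Y \<in> A")
    case True
    then have "marking V1 R1 w e1"
      unfolding marking_def using e1 src pair bi by blast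
    then show ?thesis by blast
  next
    case False
    then obtain Y0 where Y0: "w Y0 \<notin> A" by blast
    then have e0: "e1 Y0 = b" using mark_east by (simp add: e1_def)
    define Z where "Z = (case Y0 of North \<Rightarrow> South | South \<Rightarrow> North)"
    have Z: "Z \<noteq> Y0" "Y = Y0 \<or> Y = Z" for Y
      unfolding Z_def by (cases Y0; simp) (cases Y; cases Y0; simp)
    \<comment> \<open>If \<open>w Z\<close> is lost as well, any source will do: every mixed side
      then contains \<open>b\<close>, so the next claim is vacuous.\<close>
    obtain s where s: "s \<in> sources V1 R1" "w Z \<in> A \<Longrightarrow> s = w Z" using src s.W_ne by blast
    have avoid: "s \<in> S \<and> e1 Z \<in> S" if "s.bi S" "b \<notin> S" for S
      using pair[OF that(1)] that(2) Y0 Z s(2) by metis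
    obtain x where x: "x \<in> sources V1 R1"
      "\<And>S. s.bi S \<Longrightarrow> (x \<in> S \<and> b \<in> S) \<or> (s \<in> S \<and> e1 Z \<in> S)"
    proof (rule s.pair_extension[of b "e1 Z" s])
      show "b \<in> sinks V1 R1" "e1 Z \<in> sinks V1 R1" using e1[of Y0] e1[of Z] e0 by auto
      show "s \<in> sources V1 R1" by (rule s(1))
      show "s \<in> S \<and> e1 Z \<in> S" if "s.bi S" "b \<notin> S" for S using avoid that .
    qed blast
    define w1 where "w1 Y = (if Y = Y0 then x else s)" for Y
    have hit: "\<exists>Y. w1 Y \<in> S \<and> e1 Y \<in> S" if "s.bi S" for S
      using x(2)[OF that] e0 Z(1) unfolding w1_def by metis
    have "w1 Y \<in> sources V1 R1" for Y using x(1) s(1) by (simp add: w1_def)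
    then have "marking V1 R1 w1 e1"
      unfolding marking_def using e1 hit bi by blast
    moreover have "w1 Y = w Y" if "w Y \<in> A" for Y
      using that Y0 Z(2)[of Y] s(2) by (auto simp: w1_def)
    ultimately show ?thesis by blast
  qed
qed

end

lemma marking_halves:
  assumes m: "marking V R w e"
  obtains w1 e1 w2 e2 where "marking V1 R1 w1 e1" "marking V2 R2 w2 e2"
    "\<forall>Y. e1 Y = b \<or> w2 Y = c"
    "\<forall>Y. (if w2 Y = c then w1 Y else w2 Y) = w Y" "\<forall>Y. (if e1 Y = b then e2 Y else e1 Y) = e Y"
proof -
  define f1 where "f1 Y = (if e Y \<in> A then e Y else b)" for Y
  define w2 where "w2 Y = (if w Y \<in> V - A then w Y else c)" for Y
  have V: "w Y \<in> V" "e Y \<in> V" for Y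
    using markingD(1,2)[OF m] sources_subset sinks_subset by blast+
  obtain w1 where w1: "marking V1 R1 w1 f1" "\<And>Y. w Y \<in> A \<Longrightarrow> w1 Y = w Y"
    using marking_V1[OF m f1_def] by blast
  have m': "marking V (R\<inverse>) e w" using m by simp
  obtain e2 where e2: "marking V2 (R2\<inverse>) e2 w2" "\<And>Y. e Y \<in> V - A \<Longrightarrow> e2 Y = e Y"
    using tree_uncut.marking_V1[OF dual_uncut m' w2_def] unfolding dual_V1 dual_R1 by blast
  show ?thesis
  proof (rule that[of w1 f1 w2 e2])
    show "marking V1 R1 w1 f1" by (rule w1)
    show "marking V2 R2 w2 e2" using e2(1) by simp
    show "\<forall>Y. f1 Y = b \<or> w2 Y = c" using mark_east[OF m f1_def] by (auto simp: f1_def w2_def)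
    show "\<forall>Y. (if w2 Y = c then w1 Y else w2 Y) = w Y"
      using w1(2) V fresh by (auto simp: w2_def)
    show "\<forall>Y. (if f1 Y = b then e2 Y else f1 Y) = e Y"
      using e2(2) V fresh by (auto simp: f1_def)
  qed
qed

end

text \<open>The leaves of the distinguished edges are prescribed along with the graph, which is the
  strengthening that the induction over trees needs.\<close>

definition realises :: "'a ctree \<Rightarrow> 'a set \<Rightarrow> ('a \<times> 'a) set \<Rightarrow> (ns \<Rightarrow> 'a) \<Rightarrow> (ns \<Rightarrow> 'a) \<Rightarrow> bool" where
  "realises G V R w e \<longleftrightarrow> construction G \<and> root_graph G = \<lparr>pverts = V, parcs = R\<rparr> \<and>
     (\<forall>Y. fst (root_edge G Y West) = w Y \<and> snd (root_edge G Y East) = e Y)"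

text \<open>Every neighbour of an inner vertex \<open>v\<close> is a leaf, because no arc joins two
  inner vertices, and by functionality each such leaf is adjacent to \<open>v\<close> only. So
  \<open>v\<close> and its neighbours form a closed set, which is the whole tree.\<close>

lemma star_realised:
  assumes T: "WE_tree V R" and m: "marking V R w e"
    and leaf: "\<And>a d. (a, d) \<in> R \<Longrightarrow> a \<in> sources V R \<or> d \<in> sinks V R"
  shows "\<exists>G. realises G V R w e"
proof -
  interpret T: WE_tree V R by (rule T)
  obtain v where v: "v \<in> V" "v \<notin> sources V R" "v \<notin> sinks V R" using T.inner by blast
  define A where "A = {u. (u, v) \<in> R}"
  define C where "C = {u. (v, u) \<in> R}"
  have Asrc: "A \<subseteq> sources V R" and Csnk: "C \<subseteq> sinks V R" using leaf v by (auto simp: A_def C_def)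
  have out: "y = v" if "x \<in> A" "(x, y) \<in> R" for x y
    using T.source_functional[of x y v] that Asrc by (auto simp: A_def)
  have in': "y = v" if "x \<in> C" "(y, x) \<in> R" for x y
    using T.sink_functional[of x y v] that Csnk by (auto simp: C_def)
  have inC: "y \<in> C" if "(v, y) \<in> R" for y using that by (simp add: C_def)
  have noA: "(y, x) \<notin> R" if "x \<in> A" for x y using that Asrc by (auto simp: sources_def)
  have noC: "(x, y) \<notin> R" if "x \<in> C" for x y using that Csnk by (auto simp: sinks_def)
  interpret s: star A v C
  proof
    show "finite A" "finite C"
      using Asrc Csnk T.sources_subset T.sinks_subset T.finite_V finite_subset by metis+
    show "A \<noteq> {}" "C \<noteq> {}" using v by (auto simp: A_def C_def sources_def sinks_def)
    show "A \<inter> C = {}" using T.antisymmetric by (auto simp: A_def C_def)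
    show "v \<notin> A" "v \<notin> C" using T.antisymmetric by (auto simp: A_def C_def)
  qed
  have sV: "x \<in> s.V \<longleftrightarrow> x \<in> A \<or> x = v \<or> x \<in> C" for x unfolding s.V_def by auto
  have sR: "(x, y) \<in> s.R \<longleftrightarrow> (x \<in> A \<and> y = v) \<or> (x = v \<and> y \<in> C)" for x y
    unfolding s.R_def by auto
  have V: "s.V = V"
  proof (rule T.closed_eq[of _ v])
    show "s.V \<subseteq> V" using v T.edges_subset by (auto simp: sV) (auto simp: A_def C_def)
    show "v \<in> s.V" by (simp add: sV)
    fix x y assume xy: "adj R x y" "x \<in> s.V"
    then consider "x \<in> A" | "x = v" | "x \<in> C" by (auto simp: sV)
    then show "y \<in> s.V"
    proof cases
      case 1
      then have "y = v" using xy(1) out noA unfolding adj_def by blast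
      then show ?thesis by (simp add: sV)
    next
      case 2
      then show ?thesis using xy(1) by (simp add: sV) (auto simp: adj_def A_def C_def)
    next
      case 3
      then have "y = v" using xy(1) in' noC unfolding adj_def by blast
      then show ?thesis by (simp add: sV)
    qed
  qed
  have R: "s.R = R"
  proof -
    have "(x, y) \<in> s.R" if xy: "(x, y) \<in> R" for x y
    proof -
      have "x \<in> s.V" using xy T.edges_subset V by auto
      then consider "x \<in> A" | "x = v" | "x \<in> C" by (auto simp: sV)
      then show ?thesis
        unfolding sR using xy out inC noC by cases blast+
    qed
    moreover have "s.R \<subseteq> R" by (auto simp: sR) (auto simp: A_def C_def)
    ultimately show ?thesis by auto
  qed
  have m': "(\<forall>Y. w Y \<in> A \<and> e Y \<in> C) \<and> (card A \<ge> 2 \<longrightarrow> w North \<noteq> w South) \<and>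
      (card C \<ge> 2 \<longrightarrow> e North \<noteq> e South)"
    using m s.marking_iff unfolding V R by blast
  define B where "B = \<lparr>graph_of = \<lparr>pverts = V, parcs = R\<rparr>,
    dist_edge = (\<lambda>Y X. case X of West \<Rightarrow> (w Y, v) | East \<Rightarrow> (v, e Y))\<rparr>"
  have "oriented_graph (graph_of B)"
    using T.finite_V T.edges_subset T.antisymmetric v by (auto simp: oriented_graph_iff B_def)
  moreover have "W_edge (graph_of B) (dist_edge B Y West)" "E_edge (graph_of B) (dist_edge B Y East)" for Y
    using m' s.sources_star s.sinks_star unfolding V R
    by (auto simp: W_edge_def E_edge_def W_vertex_iff E_vertex_iff B_def A_def C_def)
  moreover have "card A \<ge> 1" "card C \<ge> 1" using s.finite s.ne by (simp_all add: Suc_le_eq card_gt_0_iff)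
  moreover have "graph_of B = \<lparr>pverts = A \<union> {v} \<union> C, parcs = A \<times> {v} \<union> {v} \<times> C\<rparr>"
    using V R by (simp add: B_def s.V_def s.R_def)
  moreover have "card A \<ge> 2 \<longrightarrow> dist_edge B North West \<noteq> dist_edge B South West"
    "card C \<ge> 2 \<longrightarrow> dist_edge B North East \<noteq> dist_edge B South East"
    using m' by (auto simp: B_def)
  ultimately have "basic_K_graph B"
    unfolding basic_K_graph_def using s.finite s.disjoint by blast
  then have "construction (Single B)" by (rule construction.basic)
  then show ?thesis
    by (intro exI[of _ "Single B"]) (simp add: realises_def root_graph_def root_edge_def B_def)
qed

lemma (in tree_cut) cut_realised:
  assumes G1: "realises G1 V1 R1 w1 e1" and G2: "realises G2 V2 R2 w2 e2"
    and extremal: "\<And>Y. e1 Y = b \<or> w2 Y = c"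
  shows "realises (cut_tree G1 (a, b) (c, d) G2) V R
    (\<lambda>Y. if w2 Y = c then w1 Y else w2 Y) (\<lambda>Y. if e1 Y = b then e2 Y else e1 Y)"
proof -
  have g1: "construction G1" "root_graph G1 = \<lparr>pverts = V1, parcs = R1\<rparr>"
      "\<And>Y. fst (root_edge G1 Y West) = w1 Y" "\<And>Y. snd (root_edge G1 Y East) = e1 Y"
    and g2: "construction G2" "root_graph G2 = \<lparr>pverts = V2, parcs = R2\<rparr>"
      "\<And>Y. fst (root_edge G2 Y West) = w2 Y" "\<And>Y. snd (root_edge G2 Y East) = e2 Y"
    using G1 G2 unfolding realises_def by auto
  \<comment> \<open>The converse direction, already proved, guarantees that the distinguished edges
    are arcs of the graphs, so prescribing their leaves determines them.\<close>
  have r1: "root_edge G1 Y X \<in> R1" and r2: "root_edge G2 Y X \<in> R2" for Y X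
    using construction_marked_tree[OF g1(1)] construction_marked_tree[OF g2(1)]
    by (simp_all add: marked_tree_def g1(2) g2(2))
  have eqE: "(c, d) = root_edge G2 Y West \<longleftrightarrow> w2 Y = c" for Y
    using R2_c(2)[of "snd (root_edge G2 Y West)"] r2[of Y West] g2(3)[of Y]
    by (metis fst_conv prod.collapse)
  have eqW: "(a, b) = root_edge G1 Y East \<longleftrightarrow> e1 Y = b" for Y
    using R1_b(2)[of "fst (root_edge G1 Y East)"] r1[of Y East] g1(4)[of Y]
    by (metis snd_conv prod.collapse)
  have "construction (cut_tree G1 (a, b) (c, d) G2)"
  proof (rule construction.cut[OF g1(1) g2(1)])
    show "disjoint_graphs (root_graph G1) (root_graph G2)"
      using disjoint by (simp add: disjoint_graphs_def g1 g2)
    show "functional_E_edge (root_graph G1) (a, b)"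
      using ab b_sink R1_b by (simp add: functional_E_edge_def E_edge_def E_vertex_iff g1)
    show "functional_W_edge (root_graph G2) (c, d)"
      using cd c_source R2_c by (simp add: functional_W_edge_def W_edge_def W_vertex_iff g2)
    show "(a, b) = root_edge G1 Y East \<or> (c, d) = root_edge G2 Y West" for Y
      using extremal[of Y] eqE eqW by blast
  qed
  moreover have "root_graph (cut_tree G1 (a, b) (c, d) G2) = \<lparr>pverts = V, parcs = R\<rparr>"
    by (simp add: cut_tree_def root_graph_def[of "Branch _ _ _"] cut_graph_def g1(2) g2(2) V_def R_def)
  moreover have "root_edge (cut_tree G1 (a, b) (c, d) G2) = cut_edge G1 (a, b) (c, d) G2"
    by (simp add: cut_tree_def root_edge_def)
  ultimately show ?thesis
    unfolding realises_def using eqE eqW g1(3,4) g2(3,4) by simp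
qed

lemma (in tree_uncut) uncut_realised:
  assumes m: "marking V R w e"
    and IH: "\<And>(V' :: 'a set) R' w' e'. card V' < card V \<Longrightarrow> WE_tree V' R' \<Longrightarrow> marking V' R' w' e' \<Longrightarrow>
      \<exists>G. realises G V' R' w' e'"
  shows "\<exists>G. realises G V R w e"
proof -
  obtain w1 e1 w2 e2 where m: "marking V1 R1 w1 e1" "marking V2 R2 w2 e2"
    and ext: "\<forall>Y. e1 Y = b \<or> w2 Y = c"
    and we: "\<forall>Y. (if w2 Y = c then w1 Y else w2 Y) = w Y"
      "\<forall>Y. (if e1 Y = b then e2 Y else e1 Y) = e Y"
    by (rule marking_halves[OF m])
  obtain G1 where G1: "realises G1 V1 R1 w1 e1"
    using IH[OF card_V1 WE_tree_V1 m(1)] by blast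
  obtain G2 where G2: "realises G2 V2 R2 w2 e2"
    using IH[OF card_V2 WE_tree_V2 m(2)] by blast
  show ?thesis
    using tree_cut.cut_realised[OF uncut_tree_cut G1 G2 ext[rule_format]]
    unfolding we[rule_format] cut_V cut_R by blast
qed

lemma marked_tree_realised:
  fixes V :: "'a set"
  assumes inf: "infinite (UNIV :: 'a set)"
    and "WE_tree V R" "marking V R w e"
  shows "\<exists>G. realises G V R w e"
  using assms(2,3)
proof (induction "card V" arbitrary: V R w e rule: less_induct)
  case less
  interpret T: WE_tree V R by (rule less.prems)
  show ?case
  proof (cases "\<exists>a d. (a, d) \<in> R \<and> a \<notin> sources V R \<and> d \<notin> sinks V R")
    case False
    then show ?thesis using star_realised[OF less.prems] by blast
  next
    case True
    then obtain a d where ad: "(a, d) \<in> R" "a \<notin> sources V R" "d \<notin> sinks V R" by blast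
    obtain A where A: "edge_split V R a d A" using T.split_exists ad by blast
    \<comment> \<open>The infinite vertex type supplies the two leaves. Being new to
      \<open>V\<close> is enough, since a cut requires disjointness of the two root graphs only;
      vertices may recur deeper in the trees.\<close>
    obtain b where b: "b \<notin> V" using inf T.finite_V ex_new_if_finite by blast
    obtain c where "c \<notin> insert b V"
      using inf T.finite_V ex_new_if_finite[of "insert b V"] by blast
    then have c: "c \<notin> V" "b \<noteq> c" by auto
    have "tree_uncut V R a d b c A"
      by (simp add: tree_uncut_def tree_uncut_axioms_def T.WE_tree_axioms ad A b c)
    then show ?thesis
      by (rule tree_uncut.uncut_realised) (use less in blast)+
  qed
qed

theorem mainTheorem1:
  fixes D :: "'a pair_pre_digraph"
  assumes "infinite (UNIV :: 'a set)"
    and "oriented_graph D"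
  shows "global_K_graph D \<longleftrightarrow> K_graph D"
proof
  assume "global_K_graph D"
  then obtain G where "construction G" "root_graph G = D" by (auto simp: global_K_graph_def)
  then have t: "marked_tree G" "root_graph G = D" using construction_marked_tree by auto
  then interpret digraph_tree D by (simp add: digraph_tree_def marked_tree_def)
  have "\<nexists>e1 e2 e3. transversal_bifurcation D e1 e2 e3"
    using t marked_no_transversal_bifurcation unfolding marked_tree_def by blast
  then show "K_graph D"
    unfolding K_graph_def
    using assms(2) tree_weakly_connected tree_asemicyclic tree_WE_functional inner
    by (auto simp: inner_vertex_iff)
next
  assume K: "K_graph D"
  then obtain v where "inner_vertex D v" by (auto simp: K_graph_def)
  then have "WE_tree (pverts D) (parcs D)" using K K_graph_tree by (auto simp: K_graph_def)
  then interpret digraph_tree D by (simp add: digraph_tree_def)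
  obtain w e where "marking (pverts D) (parcs D) w e"
    using marking_exists K unfolding K_graph_def by metis
  then obtain G where "realises G (pverts D) (parcs D) w e"
    using marked_tree_realised[OF assms(1)] WE_tree_axioms by blast
  then show "global_K_graph D"
    using assms(2) unfolding global_K_graph_def realises_def by auto
qed

end
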